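(* Let $A\in M_n(\mathbb C)$, let $D=\operatorname{diag}(|\lambda_1(A)|,\ldots,|\lambda_n(A)|)$, let $H$ be the hyperbolic element of $A$, and let $M\in \mathrm{GL}_n(\mathbb C)$ be such that $H=MDM^{-1}$. For any $B,C\in \mathrm{GL}_n(\mathbb C)$, let $M^{-1}C=LQ$ with $L\in \mathrm{GL}_n(\mathbb C)$ lower triangular and $Q\in M_n(\mathbb C)$ unitary. Then $$\lim_{m\to\infty}|BA^mC|^{1/m}=Q^*DQ,$$ and this limit is independent of $B$ and of the choice of $M$ (with $H=MDM^{-1}$). The analogous result is true for $A\in M_n(\mathbb R)$ and $B,C\in \mathrm{GL}_n(\mathbb R)$, where the unitary matrix $Q$ may be replaced by a real orthogonal matrix: taking $M\in\mathrm{GL}_n(\mathbb R)$ with $H=MDM^{-1}$ and $M^{-1}C=LQ$ with $L$ real lower triangular and $Q$ real orthogonal, one has $\lim_{m\to\infty}|BA^mC|^{1/m}=Q^{*}DQ$, independent of $B$ and of the choice of $M$.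
   Context: $M_n(\mathbb C)$ (resp. $M_n(\mathbb R)$) is the set of $n\times n$ complex (resp. real) matrices, and $\mathrm{GL}_n(\mathbb C)$ (resp. $\mathrm{GL}_n(\mathbb R)$) is the group of nonsingular ones. $X^*$ is the conjugate transpose of $X$. For $X\in M_n(\mathbb C)$, $|X|=(X^*X)^{1/2}$ is the positive semidefinite square root, and $|X|^{1/m}$ is its positive semidefinite $m$-th root. $\lambda_1(A),\ldots,\lambda_n(A)$ are the eigenvalues of $A$ counted with multiplicity and ordered so that $|\lambda_1(A)|\ge\cdots\ge|\lambda_n(A)|$. Hyperbolic element of $A\in M_n(\mathbb C)$ (possibly singular): let $\mu_1,\ldots,\mu_k$ be the distinct eigenvalues of $A$, arranged so that $|\mu_1|\ge\cdots\ge|\mu_k|$, let $n_i$ be the algebraic multiplicity of $\mu_i$, and write the Jordan form $A=M_0\big(\bigoplus_{i=1}^k J_A(\mu_i)\big)M_0^{-1}$, where $J_A(\mu_i)$ is the direct sum of the Jordan blocks of $A$ associated to $\mu_i$. The hyperbolic element of $A$ is $H=M_0\big(\bigoplus_{i=1}^k|\mu_i|I_{n_i}\big)M_0^{-1}$, which depends only on $A$; note that $\bigoplus_{i=1}^k|\mu_i|I_{n_i}=\operatorname{diag}(|\lambda_1(A)|,\ldots,|\lambda_n(A)|)$. *)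

theory Defs
  imports
    "Jordan_Normal_Form.Jordan_Normal_Form"
    "Jordan_Normal_Form.Schur_Decomposition"
begin

definition GL :: "nat \<Rightarrow> 'a :: field mat set" where
  "GL n = {X \<in> carrier_mat n n. invertible_mat X}"

definition lower_triangular :: "'a :: zero mat \<Rightarrow> bool" where
  "lower_triangular L \<longleftrightarrow> (\<forall>i < dim_row L. \<forall>j < dim_col L. i < j \<longrightarrow> L $$ (i, j) = 0)"

definition unitary_group :: "nat \<Rightarrow> complex mat set" where
  "unitary_group n = {U \<in> carrier_mat n n. mat_adjoint U * U = 1\<^sub>m n \<and> U * mat_adjoint U = 1\<^sub>m n}"

definition orthogonal_group :: "nat \<Rightarrow> real mat set" where
  "orthogonal_group n =
     {U \<in> carrier_mat n n. transpose_mat U * U = 1\<^sub>m n \<and> U * transpose_mat U = 1\<^sub>m n}"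

abbreviation cmat :: "real mat \<Rightarrow> complex mat" where
  "cmat \<equiv> map_mat complex_of_real"

definition psd :: "complex mat \<Rightarrow> bool" where
  "psd P \<longleftrightarrow> square_mat P \<and> mat_adjoint P = P \<and>
     (\<forall>v \<in> carrier_vec (dim_row P). 0 \<le> Re ((P *\<^sub>v v) \<bullet>c v))"

text \<open>The positive semidefinite \<open>m\<close>-th root; it exists and is unique if \<open>P\<close> is positive
  semidefinite and \<open>m > 0\<close>, and is unspecified otherwise.\<close>

definition psd_root :: "nat \<Rightarrow> complex mat \<Rightarrow> complex mat" where
  "psd_root m P = (THE R. R \<in> carrier_mat (dim_row P) (dim_row P) \<and> psd R \<and> R ^\<^sub>m m = P)"

definition mat_abs :: "complex mat \<Rightarrow> complex mat" where
  "mat_abs X = psd_root 2 (mat_adjoint X * X)"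

definition ordered_eigenvalues :: "complex mat \<Rightarrow> complex list \<Rightarrow> bool" where
  "ordered_eigenvalues A ls \<longleftrightarrow>
     char_poly A = (\<Prod>l\<leftarrow>ls. [:- l, 1:]) \<and> sorted_wrt (\<lambda>x y. cmod x \<ge> cmod y) ls"

definition modulus_diag :: "complex list \<Rightarrow> real mat" where
  "modulus_diag ls = mat_diag (length ls) (\<lambda>i. cmod (ls ! i))"

text \<open>In the following definition \<open>mus\<close> lists the distinct eigenvalues, \<open>sizes \<mu>\<close> lists the sizes
  of the Jordan blocks for \<open>\<mu>\<close> (so that \<open>J \<mu>\<close> is the direct sum of these blocks), and \<open>N0\<close> is the
  inverse of \<open>M0\<close>. The matrix \<open>H\<close> does not depend on the choice of \<open>mus\<close>, \<open>sizes\<close> and \<open>M0\<close>.\<close>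

definition hyperbolic_element :: "complex mat \<Rightarrow> complex mat \<Rightarrow> bool" where
  "hyperbolic_element A H \<longleftrightarrow>
     (\<exists>mus sizes M0 N0.
        let J = (\<lambda>\<mu>. jordan_matrix (map (\<lambda>s. (s, \<mu>)) (sizes \<mu>)));
            mult = (\<lambda>\<mu>. Polynomial.order \<mu> (char_poly A))
        in distinct mus \<and> set mus = {\<mu>. eigenvalue A \<mu>} \<and>
           sorted_wrt (\<lambda>x y. cmod x \<ge> cmod y) mus \<and>
           (\<forall>\<mu> \<in> set mus. 0 \<notin> set (sizes \<mu>)) \<and>
           similar_mat_wit A (diag_block_mat (map J mus)) M0 N0 \<and>
           H = M0 * diag_block_mat
                 (map (\<lambda>\<mu>. complex_of_real (cmod \<mu>) \<cdot>\<^sub>m 1\<^sub>m (mult \<mu>)) mus) * N0)"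

text \<open>Convergence of \<open>n \<times> n\<close> matrices is entrywise, which is convergence in any norm on this
  finite-dimensional space. The dimensions are only required to match eventually because
  \<open>psd_root 0\<close> is unspecified.\<close>

definition mat_LIMSEQ :: "nat \<Rightarrow> (nat \<Rightarrow> complex mat) \<Rightarrow> complex mat \<Rightarrow> bool" where
  "mat_LIMSEQ n X E \<longleftrightarrow>
     E \<in> carrier_mat n n \<and> (\<forall>\<^sub>F m in sequentially. X m \<in> carrier_mat n n) \<and>
     (\<forall>i < n. \<forall>j < n. (\<lambda>m. X m $$ (i, j)) \<longlonglongrightarrow> E $$ (i, j))"

end

theory Submission
  imports Defs "Jordan_Normal_Form.Spectral_Radius"
begin

text \<open>Put \<open>Y = B * A\<^sup>m * C * Q\<^sup>*\<close>. Since \<open>A\<close> commutes with its hyperbolic element and differs from it, up to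
  a nilpotent part, by a factor with all eigenvalues on the unit circle, and since \<open>L\<close> is lower
  triangular while the diagonal of \<open>D\<close> decreases, one has \<open>Y = F * D\<^sup>m\<close> and \<open>D\<^sup>m = G * Y\<close> for large \<open>m\<close>,
  where \<open>F\<close> and \<open>G\<close> grow at most polynomially in \<open>m\<close>, say with bound \<open>q\<close>. Diagonalize
  \<open>|Y|\<^sup>1\<^sup>/\<^sup>m = W * diag r * W\<^sup>*\<close> with \<open>W\<close> unitary. The two factorizations give
  \<open>d\<^sub>i\<^sup>m |W\<^sub>i\<^sub>j| \<le> q r\<^sub>j\<^sup>m\<close> and \<open>r\<^sub>j\<^sup>m |W\<^sub>i\<^sub>j| \<le> q d\<^sub>i\<^sup>m\<close>, so \<open>W\<^sub>i\<^sub>j\<close> is exponentially small unless \<open>r\<^sub>j\<close> is close to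
  \<open>d\<^sub>i\<close>. Hence \<open>W * diag r * W\<^sup>*\<close> converges to \<open>D\<close>, and conjugating by \<open>Q\<close> gives the limit.
  Independence of \<open>B\<close> and \<open>M\<close> is uniqueness of limits, as \<open>Q\<^sup>* * D * Q\<close> does not involve \<open>B\<close>.\<close>

section \<open>Unitary diagonalization and positive semidefinite roots\<close>

lemma index_mult_sum:
  assumes "A \<in> carrier_mat nr n" "B \<in> carrier_mat n nc" "i < nr" "j < nc"
  shows "(A * B) $$ (i,j) = (\<Sum>k<n. A $$ (i,k) * B $$ (k,j))"
  using assms by (auto simp: scalar_prod_def lessThan_atLeast0 intro!: sum.cong)

lemma adjoint_carrier[simp]: "A \<in> carrier_mat nr nc \<Longrightarrow> mat_adjoint A \<in> carrier_mat nc nr"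
  by (auto simp: mat_adjoint_def)

lemma adjoint_dim[simp]: "dim_row (mat_adjoint A) = dim_col A" "dim_col (mat_adjoint A) = dim_row A"
  by (auto simp: mat_adjoint_def)

lemma adjoint_index[simp]:
  "i < dim_col A \<Longrightarrow> j < dim_row A \<Longrightarrow> mat_adjoint A $$ (i,j) = conjugate (A $$ (j,i))"
  unfolding mat_adjoint_def by (subst mat_of_rows_index) auto

lemma adjoint_adjoint[simp]: "mat_adjoint (mat_adjoint A) = A"
  by (rule eq_matI) auto

lemma adjoint_mult:
  fixes A B :: "complex mat"
  assumes A: "A \<in> carrier_mat nr n" and B: "B \<in> carrier_mat n nc"
  shows "mat_adjoint (A * B) = mat_adjoint B * mat_adjoint A"
proof (rule eq_matI)
  fix i j assume "i < dim_row (mat_adjoint B * mat_adjoint A)" "j < dim_col (mat_adjoint B * mat_adjoint A)"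
  hence i: "i < nc" and j: "j < nr" using A B by auto
  show "mat_adjoint (A * B) $$ (i, j) = (mat_adjoint B * mat_adjoint A) $$ (i, j)"
    using A B i j
    by (simp add: index_mult_sum[OF A B j i]
        index_mult_sum[OF adjoint_carrier[OF B] adjoint_carrier[OF A] i j] sum_conjugate mult.commute
        del: index_mult_mat(1))
qed (use A B in auto)

lemma adjoint_mat_diag: "mat_adjoint (mat_diag n d :: complex mat) = mat_diag n (\<lambda>i. cnj (d i))"
  by (rule eq_matI) (auto simp: mat_diag_def)

lemma unitary_groupD:
  assumes "U \<in> unitary_group n"
  shows "U \<in> carrier_mat n n" "mat_adjoint U \<in> carrier_mat n n"
    "mat_adjoint U * U = 1\<^sub>m n" "U * mat_adjoint U = 1\<^sub>m n"
  using assms by (auto simp: unitary_group_def)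

lemma unitary_groupI:
  assumes "U \<in> carrier_mat n n" "mat_adjoint U * U = 1\<^sub>m n"
  shows "U \<in> unitary_group n"
  using assms mat_mult_left_right_inverse[OF adjoint_carrier[OF assms(1)] assms(1,2)]
  by (auto simp: unitary_group_def)

lemma adjoint_unitary: "U \<in> unitary_group n \<Longrightarrow> mat_adjoint U \<in> unitary_group n"
  by (auto simp: unitary_group_def)

lemma unitary_mult:
  assumes "U \<in> unitary_group n" "V \<in> unitary_group n"
  shows "U * V \<in> unitary_group n"
proof (rule unitary_groupI)
  note U = unitary_groupD[OF assms(1)] and V = unitary_groupD[OF assms(2)]
  note [simp] = U(1,2) V(1,2)
  show "U * V \<in> carrier_mat n n" by (simp add: mult_carrier_mat[of _ _ n])
  have "mat_adjoint (U * V) * (U * V) = mat_adjoint V * (mat_adjoint U * U * V)"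
    by (simp add: adjoint_mult[of _ n n _ n] assoc_mult_mat[of _ n n _ n _ n] mult_carrier_mat[of _ n n _ n])
  also have "\<dots> = 1\<^sub>m n" by (simp add: U(3) V(3) left_mult_one_mat[OF V(1)])
  finally show "mat_adjoint (U * V) * (U * V) = 1\<^sub>m n" .
qed

text \<open>Extend \<open>v\<close> to a basis that starts with \<open>v\<close> and orthogonalize
  it. Gram-Schmidt leaves the first vector alone, so after normalization the first column is still a
  multiple of \<open>v\<close>.\<close>

lemma unitary_completion:
  assumes v: "v \<in> carrier_vec n" and v0: "v \<noteq> 0\<^sub>v n"
  obtains U c where "U \<in> unitary_group n" "col U 0 = c \<cdot>\<^sub>v v"
proof -
  interpret cof_vec_space n "TYPE(complex)" .
  have n: "n > 0" using v v0 by (cases n) auto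
  note bc = basis_completion[OF v v0]
  define ws where "ws = gram_schmidt n (basis_completion v)"
  from gram_schmidt_result[OF bc(2,4,5) refl, folded ws_def] bc(6)
  have ws: "set ws \<subseteq> carrier_vec n" "corthogonal ws" "length ws = n" by auto
  have hd: "hd ws = v" unfolding ws_def basis_completion_def Let_def using v by simp
  define W where "W = mat_of_cols n ws"
  have W: "W \<in> carrier_mat n n" using ws by (auto simp: W_def)
  \<comment> \<open>Reciprocal norms of the orthogonal vectors: the diagonal matrix on the right
    normalizes the columns of \<open>W\<close>.\<close>
  define f where "f i = complex_of_real (1 / sqrt (Re (ws ! i \<bullet>c ws ! i)))" for i
  define U where "U = W * mat_diag n f"
  have U: "U \<in> carrier_mat n n" using W by (simp add: U_def mult_carrier_mat[of _ _ n])
  have Uind: "U $$ (i,j) = (ws ! j) $ i * f j" if "i < n" "j < n" for i j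
    using that ws(3) by (simp add: U_def mat_diag_mult_right[OF W]) (simp add: W_def mat_of_cols_index)
  have wc: "ws ! i \<in> carrier_vec n" if "i < n" for i using ws that by auto
  have sq: "ws ! i \<bullet>c ws ! i = complex_of_real (Re (ws ! i \<bullet>c ws ! i)) \<and> Re (ws ! i \<bullet>c ws ! i) > 0"
    if i: "i < n" for i
  proof -
    have "0 \<le> ws ! i \<bullet>c ws ! i" by (rule conjugate_square_ge_0_vec)
    moreover have "ws ! i \<bullet>c ws ! i \<noteq> 0" using corthogonalD[OF ws(2), of i i] i ws(3) by auto
    ultimately have "0 < ws ! i \<bullet>c ws ! i" by (simp add: less_le)
    thus ?thesis by (auto simp: less_complex_def complex_eq_iff)
  qed
  have "mat_adjoint U * U = 1\<^sub>m n"
  proof (rule eq_matI)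
    fix i j assume "i < dim_row (1\<^sub>m n)" "j < dim_col (1\<^sub>m n)"
    hence i: "i < n" and j: "j < n" by auto
    have "(mat_adjoint U * U) $$ (i,j) = (\<Sum>k<n. cnj (U $$ (k,i)) * U $$ (k,j))"
      using U i j by (simp add: index_mult_sum[OF adjoint_carrier[OF U] U i j] del: index_mult_mat(1))
    also have "\<dots> = (\<Sum>k<n. (cnj (f i) * f j) * (ws ! j $ k * cnj (ws ! i $ k)))"
      by (rule sum.cong) (auto simp: Uind i j)
    also have "\<dots> = (cnj (f i) * f j) * (ws ! j \<bullet>c ws ! i)"
      using wc[OF i] wc[OF j] by (simp add: scalar_prod_def sum_distrib_left lessThan_atLeast0)
    also have "\<dots> = (if i = j then 1 else 0)"
    proof (cases "i = j")
      case True
      have "cnj (f i) * f i * (ws ! i \<bullet>c ws ! i)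
          = complex_of_real ((1 / sqrt (Re (ws ! i \<bullet>c ws ! i)))^2 * Re (ws ! i \<bullet>c ws ! i))"
        using sq[OF i] by (metis complex_cnj_complex_of_real f_def of_real_mult power2_eq_square)
      also have "\<dots> = 1" using sq[OF i] by (simp add: power_divide)
      finally show ?thesis using True by simp
    next
      case False
      hence "ws ! j \<bullet>c ws ! i = 0" using corthogonalD[OF ws(2), of j i] i j ws(3) by auto
      thus ?thesis using False by simp
    qed
    finally show "(mat_adjoint U * U) $$ (i,j) = 1\<^sub>m n $$ (i,j)" using i j by simp
  qed (use U in auto)
  hence "U \<in> unitary_group n" by (rule unitary_groupI[OF U])
  moreover have "col U 0 = f 0 \<cdot>\<^sub>v v"
  proof -
    have "ws ! 0 = v" using hd ws(3) n by (cases ws) auto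
    thus ?thesis using U v n by (intro eq_vecI) (auto simp: Uind)
  qed
  ultimately show ?thesis using that by blast
qed

text \<open>Deflation: conjugating by a unitary matrix whose first column is an eigenvector clears
  the first column below the corner. As the result is again Hermitian, a block of size 1 splits off,
  and the induction hypothesis diagonalizes the other block.\<close>

lemma hermitian_diagonalization:
  fixes A :: "complex mat"
  assumes "A \<in> carrier_mat n n" "mat_adjoint A = A"
  shows "\<exists>U d. U \<in> unitary_group n \<and> mat_adjoint U * A * U = mat_diag n d"
  using assms
proof (induction n arbitrary: A)
  case 0
  have "mat_adjoint (1\<^sub>m 0) * A * 1\<^sub>m 0 = mat_diag 0 (\<lambda>_. 0)" using 0 by (intro eq_matI) (auto simp: mat_diag_def)
  moreover have "1\<^sub>m 0 \<in> unitary_group 0" by (rule unitary_groupI) auto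
  ultimately show ?case by blast
next
  case (Suc n)
  let ?n = "Suc n"
  note A = Suc.prems(1)
  obtain e where "eigenvalue A e" using spectrum_non_empty[OF A] by (auto simp: spectrum_def)
  then obtain v where v: "v \<in> carrier_vec ?n" "v \<noteq> 0\<^sub>v ?n" "A *\<^sub>v v = e \<cdot>\<^sub>v v"
    using A by (auto simp: eigenvalue_def eigenvector_def)
  obtain U c where Uu: "U \<in> unitary_group ?n" and Uc: "col U 0 = c \<cdot>\<^sub>v v"
    using unitary_completion[OF v(1,2)] .
  note U = unitary_groupD[OF Uu]
  define A' where "A' = mat_adjoint U * A * U"
  have A': "A' \<in> carrier_mat ?n ?n" using A U by (auto simp: A'_def mult_carrier_mat[of _ ?n ?n])
  have herm: "mat_adjoint A' = A'"
    unfolding A'_def using A U Suc.prems(2)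
    by (simp add: adjoint_mult[of _ ?n ?n _ ?n] assoc_mult_mat[of _ ?n ?n _ ?n _ ?n] mult_carrier_mat[of _ ?n ?n _ ?n])
  have col0: "A' $$ (i,0) = (if i = 0 then e else 0)" if i: "i < ?n" for i
  proof -
    have "A' $$ (i,0) = col (mat_adjoint U * (A * U)) 0 $ i"
      using A U A' i by (simp add: A'_def assoc_mult_mat[of _ ?n ?n _ ?n _ ?n])
    also have "col (mat_adjoint U * (A * U)) 0 = mat_adjoint U *\<^sub>v (A *\<^sub>v (c \<cdot>\<^sub>v v))"
      unfolding Uc[symmetric] col_mult2[OF A U(1) zero_less_Suc, symmetric]
      by (rule col_mult2[OF U(2) mult_carrier_mat[OF A U(1)] zero_less_Suc])
    also have "A *\<^sub>v (c \<cdot>\<^sub>v v) = e \<cdot>\<^sub>v col U 0"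
      using A v Uc by (simp add: mult_mat_vec[of _ ?n ?n] smult_smult_assoc mult.commute)
    also have "mat_adjoint U *\<^sub>v (e \<cdot>\<^sub>v col U 0) = e \<cdot>\<^sub>v (mat_adjoint U *\<^sub>v col U 0)"
      by (rule mult_mat_vec[OF U(2)]) (use U(1) in \<open>simp add: carrier_vecI\<close>)
    also have "mat_adjoint U *\<^sub>v col U 0 = col (mat_adjoint U * U) 0"
      by (rule col_mult2[OF U(2,1), symmetric]) simp
    finally show ?thesis using i by (simp add: U)
  qed
  obtain A1 A2 A0 A3 where sp: "split_block A' 1 1 = (A1,A2,A0,A3)" by (cases "split_block A' 1 1") auto
  have "dim_row A' = 1 + n" "dim_col A' = 1 + n" using A' by auto
  note blk = split_block[OF sp this]
  have ix: "A0 = 0\<^sub>m n 1" "A2 = 0\<^sub>m 1 n" "A1 = mat_diag 1 (\<lambda>_. e)"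
  proof -
    show "A0 = 0\<^sub>m n 1"
    proof (rule eq_matI)
      fix i j assume "i < dim_row (0\<^sub>m n 1)" "j < dim_col (0\<^sub>m n 1)"
      thus "A0 $$ (i,j) = 0\<^sub>m n 1 $$ (i,j)" using blk col0[of "Suc i"] by auto
    qed (use blk in auto)
    \<comment> \<open>Hermitian symmetry carries the zeros of the first column over to the first
      row.\<close>
    have row0: "A' $$ (0,j) = (if j = 0 then cnj e else 0)" if j: "j < ?n" for j
    proof -
      have "A' $$ (0,j) = mat_adjoint A' $$ (0,j)" by (simp add: herm)
      thus ?thesis using col0[OF j] j A' by auto
    qed
    show "A2 = 0\<^sub>m 1 n"
    proof (rule eq_matI)
      fix i j assume "i < dim_row (0\<^sub>m 1 n)" "j < dim_col (0\<^sub>m 1 n)"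
      thus "A2 $$ (i,j) = 0\<^sub>m 1 n $$ (i,j)" using blk row0[of "Suc j"] by auto
    qed (use blk in auto)
    show "A1 = mat_diag 1 (\<lambda>_. e)"
      using blk col0[of 0] by (intro eq_matI) (auto simp: mat_diag_def)
  qed
  have "mat_adjoint A3 = A3"
  proof (rule eq_matI)
    fix i j assume ij: "i < dim_row A3" "j < dim_col A3"
    have "mat_adjoint A' $$ (Suc i, Suc j) = A' $$ (Suc i, Suc j)" by (simp add: herm)
    thus "mat_adjoint A3 $$ (i,j) = A3 $$ (i,j)" using ij blk A' by (auto simp: blk(5))
  qed (use blk in auto)
  from Suc.IH[OF blk(4) this] obtain V d where Vu: "V \<in> unitary_group n"
    and Vd: "mat_adjoint V * A3 * V = mat_diag n d" by auto
  note V = unitary_groupD[OF Vu]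
  \<comment> \<open>\<open>V'\<close> fixes the coordinate that has been split off and acts as
    \<open>V\<close> on the remaining block.\<close>
  define V' where "V' = four_block_mat (1\<^sub>m 1) (0\<^sub>m 1 n) (0\<^sub>m n 1) V"
  have adjV': "mat_adjoint V' = four_block_mat (1\<^sub>m 1) (0\<^sub>m 1 n) (0\<^sub>m n 1) (mat_adjoint V)"
    unfolding V'_def by (rule eq_matI) (use V in auto)
  have V': "V' \<in> carrier_mat ?n ?n" using V four_block_carrier_mat[of "1\<^sub>m 1" 1 1 V n n] by (simp add: V'_def)
  have "mat_adjoint V' * V' = 1\<^sub>m ?n"
    unfolding adjV' using V unfolding V'_def
    by (subst mult_four_block_mat[of _ 1 1 _ n _ n _ _ 1 _ n])
       (auto simp: four_block_one_mat[of 1 n, simplified])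
  hence V'u: "V' \<in> unitary_group ?n" by (rule unitary_groupI[OF V'])
  have "A' * V' = four_block_mat A1 (0\<^sub>m 1 n) (0\<^sub>m n 1) (A3 * V)"
    unfolding V'_def blk(5) ix(1,2) using V blk
    by (subst mult_four_block_mat[of _ 1 1 _ n _ n _ _ 1 _ n]) auto
  hence "mat_adjoint V' * (A' * V') = four_block_mat A1 (0\<^sub>m 1 n) (0\<^sub>m n 1) (mat_adjoint V * (A3 * V))"
    unfolding adjV' using V blk
    by (simp, subst mult_four_block_mat[of _ 1 1 _ n _ n _ _ 1 _ n]) auto
  also have "mat_adjoint V * (A3 * V) = mat_diag n d"
    using Vd V blk by (simp add: assoc_mult_mat[of _ n n _ n _ n])
  also have "four_block_mat A1 (0\<^sub>m 1 n) (0\<^sub>m n 1) (mat_diag n d)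
      = mat_diag ?n (\<lambda>i. if i = 0 then e else d (i - 1))"
    by (rule eq_matI) (auto simp: ix mat_diag_def)
  finally have fin: "mat_adjoint V' * (A' * V') = mat_diag ?n (\<lambda>i. if i = 0 then e else d (i - 1))" .
  have "mat_adjoint (U * V') * A * (U * V') = mat_adjoint V' * (A' * V')"
    unfolding A'_def using A U V' unitary_groupD[OF V'u]
    by (simp add: adjoint_mult[of _ ?n ?n _ ?n] assoc_mult_mat[of _ ?n ?n _ ?n _ ?n] mult_carrier_mat[of _ ?n ?n _ ?n])
  with fin unitary_mult[OF Uu V'u] show ?case by metis
qed

section \<open>Positive semidefinite matrices and their spectral form\<close>

lemma adjoint_scalar_prod:
  fixes X :: "complex mat"
  assumes X: "X \<in> carrier_mat nr nc" and u: "u \<in> carrier_vec nr" and v: "v \<in> carrier_vec nc"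
  shows "(mat_adjoint X *\<^sub>v u) \<bullet>c v = u \<bullet>c (X *\<^sub>v v)"
proof -
  have "(mat_adjoint X *\<^sub>v u) \<bullet>c v = (\<Sum>i<nc. \<Sum>k<nr. u $ k * cnj (X $$ (k,i) * v $ i))"
    using X u v by (auto simp: scalar_prod_def lessThan_atLeast0 sum_distrib_right intro!: sum.cong)
  also have "\<dots> = (\<Sum>k<nr. \<Sum>i<nc. u $ k * cnj (X $$ (k,i) * v $ i))" by (rule sum.swap)
  also have "\<dots> = u \<bullet>c (X *\<^sub>v v)"
    using X u v by (auto simp: scalar_prod_def lessThan_atLeast0 sum_distrib_left intro!: sum.cong)
  finally show ?thesis .
qed

lemma psd_gram:
  assumes X: "X \<in> carrier_mat nr nc"
  shows "psd (mat_adjoint X * X)"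
  unfolding psd_def
proof (intro conjI ballI)
  show "square_mat (mat_adjoint X * X)" using X by simp
  show "mat_adjoint (mat_adjoint X * X) = mat_adjoint X * X"
    using X by (simp add: adjoint_mult[of _ nc nr _ nc])
  fix v :: "complex vec" assume "v \<in> carrier_vec (dim_row (mat_adjoint X * X))"
  hence v: "v \<in> carrier_vec nc" using X by simp
  have "(mat_adjoint X * X *\<^sub>v v) \<bullet>c v = (X *\<^sub>v v) \<bullet>c (X *\<^sub>v v)"
    using X v by (simp add: assoc_mult_mat_vec[of _ nc nr _ nc] adjoint_scalar_prod[of _ nr nc]
        mult_mat_vec_carrier[of _ nr nc])
  moreover have "0 \<le> (X *\<^sub>v v) \<bullet>c (X *\<^sub>v v)" by (rule conjugate_square_ge_0_vec)
  ultimately show "0 \<le> Re ((mat_adjoint X * X *\<^sub>v v) \<bullet>c v)" by (simp add: less_eq_complex_def)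
qed

text \<open>Eigenvectors and real eigenvalues are kept apart, so that powers and roots only change
  \<open>d\<close>.\<close>

definition spectral_mat :: "nat \<Rightarrow> complex mat \<Rightarrow> (nat \<Rightarrow> real) \<Rightarrow> complex mat" where
  "spectral_mat n U d = U * mat_diag n (\<lambda>i. complex_of_real (d i)) * mat_adjoint U"

lemma spectral_mat_carrier[simp]: "U \<in> unitary_group n \<Longrightarrow> spectral_mat n U d \<in> carrier_mat n n"
  using unitary_groupD[of U n] by (auto simp: spectral_mat_def intro!: mult_carrier_mat[of _ n n])

lemma mat_diag_pow: "mat_diag n d ^\<^sub>m k = mat_diag n (\<lambda>i. d i ^ k :: 'a :: comm_semiring_1)"
proof (induction k)
  case 0
  show ?case by (simp add: mat_diag_def one_mat_def)
next
  case (Suc k)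
  thus ?case by (simp add: mult.commute)
qed

lemma spectral_mat_pow:
  assumes "U \<in> unitary_group n"
  shows "spectral_mat n U d ^\<^sub>m k = spectral_mat n U (\<lambda>i. d i ^ k)"
proof -
  note U = unitary_groupD[OF assms]
  have "similar_mat_wit (spectral_mat n U d) (mat_diag n (\<lambda>i. complex_of_real (d i))) U (mat_adjoint U)"
    by (rule similar_mat_witI[of _ _ n]) (use U assms spectral_mat_carrier[OF assms] in \<open>simp_all add: spectral_mat_def\<close>)
  from similar_mat_wit_pow_id[OF this, of k] show ?thesis
    by (simp add: mat_diag_pow spectral_mat_def)
qed

text \<open>With \<open>E\<close> the square root of the diagonal matrix, the product is the Gram
  matrix of \<open>E * mat_adjoint U\<close>.\<close>

lemma psd_spectral_mat:
  assumes Uu: "U \<in> unitary_group n" and d: "\<And>i. i < n \<Longrightarrow> 0 \<le> d i"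
  shows "psd (spectral_mat n U d)"
proof -
  note U = unitary_groupD[OF Uu]
  define E where "E = mat_diag n (\<lambda>i. complex_of_real (sqrt (d i)))"
  have E: "E \<in> carrier_mat n n" "mat_adjoint E = E" by (auto simp: E_def adjoint_mat_diag)
  have EE: "E * E = mat_diag n (\<lambda>i. complex_of_real (d i))"
    unfolding E_def mat_diag_diag using d
    by (intro eq_matI) (auto simp: mat_diag_def simp flip: of_real_mult)
  have "mat_adjoint (E * mat_adjoint U) * (E * mat_adjoint U) = U * (E * E) * mat_adjoint U"
    using U E by (simp add: adjoint_mult[of _ n n _ n] assoc_mult_mat[of _ n n _ n _ n] mult_carrier_mat[of _ n n _ n])
  hence "spectral_mat n U d = mat_adjoint (E * mat_adjoint U) * (E * mat_adjoint U)"
    by (simp add: EE spectral_mat_def)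
  thus ?thesis using psd_gram[of "E * mat_adjoint U" n n] E U by (simp add: mult_carrier_mat[of _ n n _ n])
qed

text \<open>After diagonalization, Hermitian symmetry makes each diagonal entry real, and the entry
  is the value of the quadratic form of \<open>P\<close> at a column of \<open>U\<close>, hence
  nonnegative.\<close>

lemma psd_spectral_decomposition:
  assumes P: "P \<in> carrier_mat n n" and psd: "psd P"
  obtains U d where "U \<in> unitary_group n" "\<And>i. 0 \<le> d i" "P = spectral_mat n U d"
proof -
  have herm: "mat_adjoint P = P" using psd by (simp add: psd_def)
  from hermitian_diagonalization[OF P herm] obtain U c where Uu: "U \<in> unitary_group n"
    and diag: "mat_adjoint U * P * U = mat_diag n c" by auto
  note U = unitary_groupD[OF Uu]
  have carr: "P * U \<in> carrier_mat n n" using P U by (simp add: mult_carrier_mat[of _ n n _ n])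
  have c: "c i = complex_of_real (Re (c i)) \<and> 0 \<le> Re (c i)" if i: "i < n" for i
  proof -
    have ci: "c i = (mat_adjoint U * P * U) $$ (i,i)" using i by (simp add: diag mat_diag_def)
    have "mat_adjoint (mat_adjoint U * P * U) = mat_adjoint U * P * U"
      using U P herm by (simp add: adjoint_mult[of _ n n _ n] assoc_mult_mat[of _ n n _ n _ n] mult_carrier_mat[of _ n n _ n])
    hence "mat_diag n (\<lambda>i. cnj (c i)) $$ (i,i) = mat_diag n c $$ (i,i)" by (simp add: diag adjoint_mat_diag)
    hence "cnj (c i) = c i" using i by (simp add: mat_diag_def)
    moreover have "c i = (P *\<^sub>v col U i) \<bullet>c col U i"
    proof -
      have "c i = (mat_adjoint U * (P * U)) $$ (i,i)"
        using ci U P by (simp add: assoc_mult_mat[of _ n n _ n _ n])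
      also have "\<dots> = (\<Sum>k<n. cnj (U $$ (k,i)) * (P * U) $$ (k,i))"
        using U(1) i by (simp add: index_mult_sum[OF U(2) carr i i] del: index_mult_mat(1))
      also have "\<dots> = (P *\<^sub>v col U i) \<bullet>c col U i"
        using U(1) P i by (auto simp: scalar_prod_def[of _ "conjugate _"] lessThan_atLeast0 mult.commute intro!: sum.cong)
      finally show ?thesis .
    qed
    moreover have "0 \<le> Re ((P *\<^sub>v col U i) \<bullet>c col U i)"
      using psd P U(1) i unfolding psd_def by (metis carrier_matD(1) col_carrier_vec carrier_matD(2))
    ultimately show ?thesis by (simp add: complex_eq_iff)
  qed
  \<comment> \<open>The value 0 beyond \<open>n\<close> makes nonnegativity hold for every
    index.\<close>
  define d where "d i = (if i < n then Re (c i) else 0)" for i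
  have "mat_diag n (\<lambda>i. complex_of_real (d i)) = mat_adjoint U * P * U"
    unfolding diag using c by (intro eq_matI) (auto simp: mat_diag_def d_def)
  hence "spectral_mat n U d = (U * mat_adjoint U) * P * (U * mat_adjoint U)"
    unfolding spectral_mat_def using U(1,2) P
    by (simp add: assoc_mult_mat[of _ n n _ n _ n] mult_carrier_mat[of _ n n _ n])
  hence "P = spectral_mat n U d" using U P by simp
  thus ?thesis using that[OF Uu, of d] c by (auto simp: d_def)
qed

section \<open>Roots of positive semidefinite matrices\<close>

text \<open>Equality of the powers says that the change of basis \<open>W\<close> intertwines the
  diagonals \<open>a\<^sup>m\<close> and \<open>b\<^sup>m\<close>. Entrywise,
  \<open>W $$ (i,j)\<close> is 0 or \<open>a j ^ m = b i ^ m\<close>. For nonnegative numbers this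
  gives \<open>a j = b i\<close>, so \<open>W\<close> intertwines \<open>a\<close> and
  \<open>b\<close> as well.\<close>

lemma psd_root_unique:
  assumes R: "R \<in> carrier_mat n n" "psd R" and S: "S \<in> carrier_mat n n" "psd S"
    and m: "m > 0" and eq: "R ^\<^sub>m m = S ^\<^sub>m m"
  shows "R = S"
proof -
  obtain U a where Uu: "U \<in> unitary_group n" and a: "\<And>i. 0 \<le> a i" and RU: "R = spectral_mat n U a"
    using psd_spectral_decomposition[OF R] by metis
  obtain V b where Vu: "V \<in> unitary_group n" and b: "\<And>i. 0 \<le> b i" and SV: "S = spectral_mat n V b"
    using psd_spectral_decomposition[OF S] by metis
  note U = unitary_groupD[OF Uu] and V = unitary_groupD[OF Vu]
  define W where "W = mat_adjoint V * U"
  have W: "W \<in> carrier_mat n n" using U V by (simp add: W_def mult_carrier_mat[of _ n n _ n])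
  let ?D = "\<lambda>c. mat_diag n (\<lambda>i. complex_of_real (c i))"
  have left: "W * ?D c = mat_adjoint V * spectral_mat n U c * U" for c
  proof -
    have "mat_adjoint V * spectral_mat n U c * U = W * ?D c * (mat_adjoint U * U)"
      unfolding W_def spectral_mat_def using U(1,2) V(1,2)
      by (simp add: assoc_mult_mat[of _ n n _ n _ n] mult_carrier_mat[of _ n n _ n])
    thus ?thesis by (simp add: U(3) right_mult_one_mat[OF mult_carrier_mat[OF W mat_diag_dim]])
  qed
  have right: "?D c * W = mat_adjoint V * spectral_mat n V c * U" for c
  proof -
    have "mat_adjoint V * spectral_mat n V c * U = (mat_adjoint V * V) * (?D c * W)"
      unfolding W_def spectral_mat_def using U(1,2) V(1,2)
      by (simp add: assoc_mult_mat[of _ n n _ n _ n] mult_carrier_mat[of _ n n _ n])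
    thus ?thesis by (simp add: V(3) left_mult_one_mat[OF mult_carrier_mat[OF mat_diag_dim W]])
  qed
  have "spectral_mat n U (\<lambda>i. a i ^ m) = spectral_mat n V (\<lambda>i. b i ^ m)"
    using eq by (simp add: RU SV spectral_mat_pow[OF Uu] spectral_mat_pow[OF Vu])
  hence pw: "W * ?D (\<lambda>i. a i ^ m) = ?D (\<lambda>i. b i ^ m) * W" by (simp only: left right)
  have "W * ?D a = ?D b * W"
  proof (rule eq_matI)
    fix i j assume "i < dim_row (?D b * W)" "j < dim_col (?D b * W)"
    hence i: "i < n" and j: "j < n" using W by (auto simp: mat_diag_def)
    have "W $$ (i,j) * complex_of_real (a j ^ m) = complex_of_real (b i ^ m) * W $$ (i,j)"
      using arg_cong[OF pw, of "\<lambda>X. X $$ (i,j)"] i j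
      by (simp add: mat_diag_mult_left[OF W] mat_diag_mult_right[OF W])
    hence "W $$ (i,j) = 0 \<or> a j ^ m = b i ^ m" by (metis mult.commute mult_cancel_left of_real_eq_iff)
    hence "W $$ (i,j) = 0 \<or> a j = b i" using a b m power_eq_imp_eq_base by blast
    thus "(W * ?D a) $$ (i,j) = (?D b * W) $$ (i,j)"
      using i j by (auto simp: mat_diag_mult_left[OF W] mat_diag_mult_right[OF W])
  qed (use W in \<open>auto simp: mat_diag_def\<close>)
  hence "mat_adjoint V * R * U = mat_adjoint V * S * U" by (simp only: left right RU SV)
  hence "V * (mat_adjoint V * R * U) * mat_adjoint U = V * (mat_adjoint V * S * U) * mat_adjoint U" by simp
  hence "(V * mat_adjoint V) * R * (U * mat_adjoint U) = (V * mat_adjoint V) * S * (U * mat_adjoint U)"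
    using U(1,2) V(1,2) R S by (simp add: assoc_mult_mat[of _ n n _ n _ n] mult_carrier_mat[of _ n n _ n])
  thus ?thesis using U V R S by simp
qed

lemma psd_root_spectral_mat:
  assumes U: "U \<in> unitary_group n" and d: "\<And>i. 0 \<le> d i" and m: "m > 0"
  shows "psd_root m (spectral_mat n U d) = spectral_mat n U (\<lambda>i. root m (d i))"
  unfolding psd_root_def
proof (rule the_equality)
  have pw: "spectral_mat n U (\<lambda>i. root m (d i)) ^\<^sub>m m = spectral_mat n U d"
    using d m by (simp add: spectral_mat_pow[OF U])
  have dim: "dim_row (spectral_mat n U d) = n" using spectral_mat_carrier[OF U, of d] by auto
  have ps: "psd (spectral_mat n U (\<lambda>i. root m (d i)))" by (rule psd_spectral_mat[OF U]) (use d m in simp)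
  show "spectral_mat n U (\<lambda>i. root m (d i))
      \<in> carrier_mat (dim_row (spectral_mat n U d)) (dim_row (spectral_mat n U d)) \<and>
    psd (spectral_mat n U (\<lambda>i. root m (d i))) \<and>
    spectral_mat n U (\<lambda>i. root m (d i)) ^\<^sub>m m = spectral_mat n U d"
    using pw ps U by (simp add: dim)
  fix R assume "R \<in> carrier_mat (dim_row (spectral_mat n U d)) (dim_row (spectral_mat n U d)) \<and>
    psd R \<and> R ^\<^sub>m m = spectral_mat n U d"
  hence R: "R \<in> carrier_mat n n" "psd R" and eq: "R ^\<^sub>m m = spectral_mat n U (\<lambda>i. root m (d i)) ^\<^sub>m m"
    by (auto simp: pw dim)
  show "R = spectral_mat n U (\<lambda>i. root m (d i))"
    by (rule psd_root_unique[OF R spectral_mat_carrier[OF U] ps m eq])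
qed

text \<open>The Gram matrix, the modulus and its \<open>m\<close>-th root share the eigenvectors
  \<open>U\<close>. In terms of the eigenvalues \<open>r i\<close> of the root, the singular values
  of \<open>X\<close> are \<open>r i ^ m\<close>, which is how they enter the estimates.\<close>

lemma psd_root_mat_abs:
  assumes X: "X \<in> carrier_mat n n" and m: "m > 0"
  obtains U r where "U \<in> unitary_group n" "\<And>i. 0 \<le> r i"
    "psd_root m (mat_abs X) = spectral_mat n U r"
    "mat_adjoint X * X = spectral_mat n U (\<lambda>i. (r i ^ m)\<^sup>2)"
proof -
  have "mat_adjoint X * X \<in> carrier_mat n n" using X by (simp add: mult_carrier_mat[of _ n n _ n])
  from psd_spectral_decomposition[OF this psd_gram[OF X]]
  obtain U d where U: "U \<in> unitary_group n" and d: "\<And>i. 0 \<le> d i"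
    and XX: "mat_adjoint X * X = spectral_mat n U d" by metis
  define r where "r i = root m (root 2 (d i))" for i
  have "mat_abs X = spectral_mat n U (\<lambda>i. root 2 (d i))"
    unfolding mat_abs_def XX by (rule psd_root_spectral_mat[OF U d]) simp
  moreover have "0 \<le> root 2 (d i)" for i using d by simp
  ultimately have "psd_root m (mat_abs X) = spectral_mat n U r"
    unfolding r_def using psd_root_spectral_mat[OF U _ m, of "\<lambda>i. root 2 (d i)"] by simp
  moreover have "(r i ^ m)\<^sup>2 = d i" for i using d[of i] m unfolding r_def by (simp add: real_root_pow_pos2)
  moreover have "0 \<le> r i" for i unfolding r_def using d m by simp
  ultimately show ?thesis using that[OF U, of r] XX by simp
qed

section \<open>Convergence from bounds on the spectral data\<close>

text \<open>Here \<open>x m\<close> stands for the modulus of an entry of a unitary matrix and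
  \<open>r m\<close> for an eigenvalue of the \<open>m\<close>-th root. If \<open>r m\<close> stays
  away from \<open>d\<close>, one of the two inequalities makes the weight \<open>x m\<close>
  exponentially small, up to the subexponential factor \<open>q m\<close>; otherwise
  \<open>\<bar>r m - d\<bar>\<close> itself is small.\<close>

lemma weighted_deviation_tendsto_0:
  fixes x r q :: "nat \<Rightarrow> real"
  assumes d: "0 \<le> d" and q0: "\<And>m. 0 \<le> q m"
    and q: "\<And>\<rho>. 0 \<le> \<rho> \<Longrightarrow> \<rho> < 1 \<Longrightarrow> (\<lambda>m. q m * \<rho> ^ m) \<longlonglongrightarrow> 0"
    and ev: "\<forall>\<^sub>F m in sequentially. 0 \<le> x m \<and> x m \<le> 1 \<and> 0 \<le> r m \<and>
      d ^ m * x m \<le> q m * r m ^ m \<and> r m ^ m * x m \<le> q m * d ^ m"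
  shows "(\<lambda>m. \<bar>r m - d\<bar> * x m) \<longlonglongrightarrow> 0"
proof (cases "d = 0")
  case True
  \<comment> \<open>For \<open>d = 0\<close> and \<open>m > 0\<close> the second inequality reads
    \<open>r m ^ m * x m \<le> 0\<close>, so \<open>r m\<close> or \<open>x m\<close>
    vanishes.\<close>
  have "\<forall>\<^sub>F m in sequentially. \<bar>r m - d\<bar> * x m = 0"
    using ev eventually_gt_at_top[of 0]
  proof eventually_elim
    case (elim m)
    hence "r m ^ m * x m = 0" using True by (intro antisym) (auto simp: power_0_left)
    thus ?case using True by auto
  qed
  thus ?thesis by (simp add: tendsto_eventually)
next
  case False
  hence d: "d > 0" using d by simp
  show ?thesis
  proof (rule LIMSEQ_I)
    fix e :: real assume "e > 0"
    \<comment> \<open>One half of \<open>e\<close> is spent on \<open>r m\<close> near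
      \<open>d\<close>, the other on the two geometric terms.\<close>
    define \<epsilon> where "\<epsilon> = e / 2"
    have e: "\<epsilon> > 0" using \<open>e > 0\<close> by (simp add: \<epsilon>_def)
    \<comment> \<open>\<open>\<rho>\<close> bounds \<open>r m / d\<close> when
      \<open>r m < d - \<epsilon>\<close>, and \<open>\<sigma>\<close> bounds \<open>d / r m\<close>
      when \<open>r m > d + \<epsilon>\<close>. The maximum with 0 covers the case
      \<open>\<epsilon> > d\<close>.\<close>
    define \<rho> where "\<rho> = max 0 ((d - \<epsilon>) / d)"
    define \<sigma> where "\<sigma> = d / (d + \<epsilon>)"
    have \<rho>: "0 \<le> \<rho>" "\<rho> < 1" using d e by (auto simp: \<rho>_def)
    have \<sigma>: "0 \<le> \<sigma>" "\<sigma> < 1" using d e by (auto simp: \<sigma>_def)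
    have lim: "(\<lambda>m. d * (q m * \<rho> ^ m) + (d + \<epsilon>) * (q m * \<sigma> ^ m)) \<longlonglongrightarrow> d * 0 + (d + \<epsilon>) * 0"
      by (intro tendsto_intros q \<rho> \<sigma>)
    have "\<forall>\<^sub>F m in sequentially. d * (q m * \<rho> ^ m) + (d + \<epsilon>) * (q m * \<sigma> ^ m) < \<epsilon>"
      using order_tendstoD(2)[OF lim, of \<epsilon>] e by simp
    hence "\<forall>\<^sub>F m in sequentially. \<bar>r m - d\<bar> * x m < e"
      using ev eventually_gt_at_top[of 0]
    proof eventually_elim
      case (elim m)
      let ?a = "d * (q m * \<rho> ^ m)" and ?b = "(d + \<epsilon>) * (q m * \<sigma> ^ m)"
      have ab: "0 \<le> ?a" "0 \<le> ?b" using d e q0 \<rho> \<sigma> by auto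
      consider "\<bar>r m - d\<bar> \<le> \<epsilon>" | "r m < d - \<epsilon>" | "r m > d + \<epsilon>" by linarith
      hence "\<bar>r m - d\<bar> * x m \<le> \<epsilon> + ?a + ?b"
      proof cases
        case 1
        hence "\<bar>r m - d\<bar> * x m \<le> \<epsilon> * 1" using elim e by (intro mult_mono) auto
        thus ?thesis using ab by simp
      next
        case 2
        have "r m / d \<le> \<rho>" using 2 d elim by (auto simp: \<rho>_def divide_right_mono le_max_iff_disj)
        hence "(r m / d) ^ m \<le> \<rho> ^ m" using elim d by (intro power_mono) auto
        moreover have "x m \<le> q m * (r m / d) ^ m" using elim d by (simp add: field_simps power_divide)
        ultimately have "x m \<le> q m * \<rho> ^ m" using q0[of m] by (meson mult_left_mono order_trans)
        moreover have "\<bar>r m - d\<bar> \<le> d" using 2 elim d e by auto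
        ultimately have "\<bar>r m - d\<bar> * x m \<le> ?a" using elim d by (intro mult_mono) auto
        thus ?thesis using ab e by simp
      next
        case 3
        \<comment> \<open>No upper bound on \<open>r m\<close> is available, so the deviation is
          bounded by \<open>r m\<close>, one factor \<open>r m\<close> stays with
          \<open>x m\<close>, and only the other \<open>k = m - 1\<close> factors are compared with
          \<open>d + \<epsilon>\<close>.\<close>
        obtain k where k: "m = Suc k" using elim by (cases m) auto
        have "(d + \<epsilon>) ^ k * (r m * x m) \<le> r m ^ k * (r m * x m)"
          using 3 d e elim by (intro mult_right_mono power_mono) auto
        also have "\<dots> \<le> q m * d ^ m" using elim by (simp add: k mult_ac)
        finally have "r m * x m \<le> q m * d ^ m / (d + \<epsilon>) ^ k"
          using d e by (simp add: field_simps)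
        also have "q m * d ^ m / (d + \<epsilon>) ^ k = ?b"
        proof -
          have "q m * d ^ m / t ^ k = t * (q m * (d / t) ^ m)" if "t > 0" for t
            using that by (simp add: k power_divide)
          thus ?thesis unfolding \<sigma>_def using d e by simp
        qed
        finally have "r m * x m \<le> ?b" .
        moreover have "\<bar>r m - d\<bar> * x m \<le> r m * x m" using 3 d e elim by (intro mult_right_mono) auto
        ultimately show ?thesis using ab e by simp
      qed
      thus ?case using elim by (simp add: \<epsilon>_def)
    qed
    thus "\<exists>no. \<forall>m\<ge>no. norm (\<bar>r m - d\<bar> * x m - 0) < e"
      using ev unfolding eventually_sequentially
      by (metis abs_of_nonneg diff_zero linorder_linear mult_nonneg_nonneg abs_ge_zero order_trans real_norm_def)
  qed
qed

lemma spectral_mat_index: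
  assumes U: "U \<in> carrier_mat n n" and "k < n" "i < n"
  shows "spectral_mat n U d $$ (k,i) = (\<Sum>j<n. U $$ (k,j) * complex_of_real (d j) * cnj (U $$ (i,j)))"
proof -
  have UD: "U * mat_diag n (\<lambda>i. complex_of_real (d i)) \<in> carrier_mat n n"
    using U by (simp add: mult_carrier_mat[of _ n n _ n])
  show ?thesis
    unfolding spectral_mat_def index_mult_sum[OF UD adjoint_carrier[OF U] assms(2,3)]
    using assms by (intro sum.cong) (auto simp: mat_diag_mult_right[OF U])
qed

lemma unitary_rows_orthonormal:
  assumes "U \<in> unitary_group n" "k < n" "i < n"
  shows "(\<Sum>j<n. U $$ (k,j) * cnj (U $$ (i,j))) = (if k = i then 1 else 0)"
proof -
  note U = unitary_groupD[OF assms(1)]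
  have "(U * mat_adjoint U) $$ (k,i) = (\<Sum>j<n. U $$ (k,j) * cnj (U $$ (i,j)))"
    unfolding index_mult_sum[OF U(1,2) assms(2,3)] using U assms by (intro sum.cong) auto
  thus ?thesis using assms by (simp add: U(4))
qed

lemma unitary_entry_le_1:
  assumes "U \<in> unitary_group n" "k < n" "j < n"
  shows "cmod (U $$ (k,j)) \<le> 1"
proof -
  have "complex_of_real (\<Sum>j<n. (cmod (U $$ (k,j)))\<^sup>2) = 1"
    using unitary_rows_orthonormal[OF assms(1,2,2)] by (simp add: complex_norm_square del: of_real_power)
  hence "(\<Sum>j<n. (cmod (U $$ (k,j)))\<^sup>2) = 1" using of_real_eq_1_iff by blast
  moreover have "(cmod (U $$ (k,j)))\<^sup>2 \<le> (\<Sum>j<n. (cmod (U $$ (k,j)))\<^sup>2)"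
    using assms(3) by (intro member_le_sum) auto
  ultimately have "(cmod (U $$ (k,j)))\<^sup>2 \<le> 1\<^sup>2" by simp
  thus ?thesis by (rule power2_le_imp_le) simp
qed

text \<open>Since the rows of \<open>W m\<close> are orthonormal, the entry \<open>(k,i)\<close> of
  the difference is the sum over \<open>j\<close> of
  \<open>W\<^sub>k\<^sub>j (r\<^sub>j - d\<^sub>i)\<close> times the conjugate of
  \<open>W\<^sub>i\<^sub>j\<close>. Its first factor is at most 1 in modulus, which leaves the
  weighted deviations treated above.\<close>

lemma spectral_mat_LIMSEQ:
  fixes d :: "nat \<Rightarrow> real"
  assumes d: "\<And>i. i < n \<Longrightarrow> 0 \<le> d i" and q0: "\<And>m. 0 \<le> q m"
    and q: "\<And>\<rho>. 0 \<le> \<rho> \<Longrightarrow> \<rho> < 1 \<Longrightarrow> (\<lambda>m. q m * \<rho> ^ m) \<longlonglongrightarrow> 0"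
    and W: "\<forall>\<^sub>F m in sequentially. W m \<in> unitary_group n"
    and r: "\<forall>\<^sub>F m in sequentially. \<forall>j<n. 0 \<le> r m j"
    and bd: "\<forall>\<^sub>F m in sequentially. \<forall>i<n. \<forall>j<n.
      d i ^ m * cmod (W m $$ (i,j)) \<le> q m * r m j ^ m \<and> r m j ^ m * cmod (W m $$ (i,j)) \<le> q m * d i ^ m"
  shows "mat_LIMSEQ n (\<lambda>m. spectral_mat n (W m) (r m)) (mat_diag n (\<lambda>i. complex_of_real (d i)))"
  unfolding mat_LIMSEQ_def
proof (intro conjI allI impI)
  show "\<forall>\<^sub>F m in sequentially. spectral_mat n (W m) (r m) \<in> carrier_mat n n"
    using W by eventually_elim simp
  fix k i assume k: "k < n" and i: "i < n"
  let ?D = "mat_diag n (\<lambda>i. complex_of_real (d i))"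
  have "(\<lambda>m. \<bar>r m j - d i\<bar> * cmod (W m $$ (i,j))) \<longlonglongrightarrow> 0" if j: "j < n" for j
  proof (rule weighted_deviation_tendsto_0[OF d[OF i] q0 q])
    show "\<forall>\<^sub>F m in sequentially. 0 \<le> cmod (W m $$ (i,j)) \<and> cmod (W m $$ (i,j)) \<le> 1 \<and> 0 \<le> r m j \<and>
      d i ^ m * cmod (W m $$ (i,j)) \<le> q m * r m j ^ m \<and> r m j ^ m * cmod (W m $$ (i,j)) \<le> q m * d i ^ m"
      using W r bd by eventually_elim (use i j unitary_entry_le_1 in auto)
  qed
  hence "(\<lambda>m. \<Sum>j<n. \<bar>r m j - d i\<bar> * cmod (W m $$ (i,j))) \<longlonglongrightarrow> (\<Sum>j<n. 0)"
    by (intro tendsto_sum) auto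
  hence lim: "(\<lambda>m. \<Sum>j<n. \<bar>r m j - d i\<bar> * cmod (W m $$ (i,j))) \<longlonglongrightarrow> 0" by simp
  have "\<forall>\<^sub>F m in sequentially. norm (spectral_mat n (W m) (r m) $$ (k,i) - ?D $$ (k,i))
      \<le> (\<Sum>j<n. \<bar>r m j - d i\<bar> * cmod (W m $$ (i,j)))"
    using W
  proof eventually_elim
    case (elim m)
    \<comment> \<open>The diagonal limit is expanded in the moving rows of \<open>W m\<close>, so
      that the two matrices can be subtracted term by term.\<close>
    have "?D $$ (k,i) = complex_of_real (d i) * (\<Sum>j<n. W m $$ (k,j) * cnj (W m $$ (i,j)))"
      using k i by (simp add: unitary_rows_orthonormal[OF elim k i] mat_diag_def)
    hence "spectral_mat n (W m) (r m) $$ (k,i) - ?D $$ (k,i)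
      = (\<Sum>j<n. W m $$ (k,j) * complex_of_real (r m j - d i) * cnj (W m $$ (i,j)))"
      by (simp add: spectral_mat_index[OF unitary_groupD(1)[OF elim] k i] sum_distrib_left
          sum_subtractf[symmetric] algebra_simps)
    also have "norm \<dots> \<le> (\<Sum>j<n. \<bar>r m j - d i\<bar> * cmod (W m $$ (i,j)))"
    proof (rule sum_norm_le)
      fix j assume "j \<in> {..<n}"
      hence "cmod (W m $$ (k,j)) * (\<bar>r m j - d i\<bar> * cmod (W m $$ (i,j))) \<le> 1 * (\<bar>r m j - d i\<bar> * cmod (W m $$ (i,j)))"
        using unitary_entry_le_1[OF elim k, of j] by (intro mult_right_mono) auto
      thus "norm (W m $$ (k,j) * complex_of_real (r m j - d i) * cnj (W m $$ (i,j)))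
          \<le> \<bar>r m j - d i\<bar> * cmod (W m $$ (i,j))"
        by (simp add: norm_mult mult.assoc del: of_real_diff)
    qed
    finally show ?case .
  qed
  hence "\<forall>\<^sub>F m in sequentially. norm (spectral_mat n (W m) (r m) $$ (k,i) - ?D $$ (k,i))
      \<le> norm (\<Sum>j<n. \<bar>r m j - d i\<bar> * cmod (W m $$ (i,j))) * 1"
    by eventually_elim simp
  hence "(\<lambda>m. spectral_mat n (W m) (r m) $$ (k,i) - ?D $$ (k,i)) \<longlonglongrightarrow> 0"
    by (rule tendsto_0_le[OF lim, of _ 1])
  thus "(\<lambda>m. spectral_mat n (W m) (r m) $$ (k,i)) \<longlonglongrightarrow> ?D $$ (k,i)" by (rule LIM_zero_cancel)
qed simp

section \<open>Bounds on singular vectors\<close>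

text \<open>The columns of \<open>U\<close> are right singular vectors of \<open>Y\<close>, so
  column \<open>j\<close> of \<open>Z = Y * U\<close> has norm \<open>s j\<close>. Comparing entries
  of \<open>?D * U = G * Z\<close> gives the first bound. Comparing entries of
  \<open>?S * mat_adjoint U = mat_adjoint Z * F * ?D\<close> gives the second one multiplied by
  \<open>s j\<close>.\<close>

lemma singular_vector_bounds:
  assumes Y: "Y \<in> carrier_mat n n" and Uu: "U \<in> unitary_group n"
    and YY: "mat_adjoint Y * Y = spectral_mat n U (\<lambda>j. (s j)\<^sup>2)" and s: "\<And>j. 0 \<le> s j"
    and \<delta>: "\<And>i. i < n \<Longrightarrow> 0 \<le> \<delta> i" and q: "0 \<le> q"
    and F: "F \<in> carrier_mat n n" "norm_bound F q" "Y = F * mat_diag n (\<lambda>i. complex_of_real (\<delta> i))"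
    and G: "G \<in> carrier_mat n n" "norm_bound G q" "mat_diag n (\<lambda>i. complex_of_real (\<delta> i)) = G * Y"
    and i: "i < n" and j: "j < n"
  shows "\<delta> i * cmod (U $$ (i,j)) \<le> real n * q * s j" "s j * cmod (U $$ (i,j)) \<le> real n * q * \<delta> i"
proof -
  note U = unitary_groupD[OF Uu]
  note assoc = assoc_mult_mat[of _ n n _ n _ n] mult_carrier_mat[of _ n n _ n]
  let ?D = "mat_diag n (\<lambda>i. complex_of_real (\<delta> i))"
  let ?S = "mat_diag n (\<lambda>i. complex_of_real ((s i)\<^sup>2))"
  define Z where "Z = Y * U"
  have Z: "Z \<in> carrier_mat n n" using Y U by (simp add: Z_def assoc)
  have SU: "?S * mat_adjoint U = mat_adjoint Z * Y"
  proof -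
    have "mat_adjoint Z * Y = mat_adjoint U * (mat_adjoint Y * Y)"
      unfolding Z_def using Y U(1,2) by (simp add: adjoint_mult[of _ n n _ n] assoc)
    also have "\<dots> = mat_adjoint U * U * (?S * mat_adjoint U)"
      unfolding YY spectral_mat_def using U(1,2) by (simp add: assoc)
    also have "\<dots> = ?S * mat_adjoint U"
      unfolding U(3) by (rule left_mult_one_mat[of _ n n]) (use U(2) in \<open>simp add: assoc\<close>)
    finally show ?thesis by simp
  qed
  have ZZ: "mat_adjoint Z * Z = ?S"
  proof -
    have "mat_adjoint Z * Z = mat_adjoint Z * Y * U"
      using Y U Z by (simp add: assoc Z_def)
    also have "\<dots> = ?S * (mat_adjoint U * U)" using U(1,2) by (simp add: SU[symmetric] assoc)
    finally show ?thesis by (simp add: U(3) right_mult_one_mat[OF mat_diag_dim])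
  qed
  \<comment> \<open>The diagonal of \<open>mat_adjoint Z * Z\<close> holds the squared column norms
    of \<open>Z\<close>, and an entry is at most the norm of its column.\<close>
  have Zb: "cmod (Z $$ (k,j)) \<le> s j" if k: "k < n" for k
  proof -
    have "(mat_adjoint Z * Z) $$ (j,j) = (\<Sum>k<n. cnj (Z $$ (k,j)) * Z $$ (k,j))"
      unfolding index_mult_sum[OF adjoint_carrier[OF Z] Z j j] using Z j by (intro sum.cong) auto
    also have "\<dots> = complex_of_real (\<Sum>k<n. (cmod (Z $$ (k,j)))\<^sup>2)"
      by (simp add: complex_norm_square mult.commute del: of_real_power)
    finally have "complex_of_real (\<Sum>k<n. (cmod (Z $$ (k,j)))\<^sup>2) = complex_of_real ((s j)\<^sup>2)"
      using j by (simp add: ZZ mat_diag_def)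
    hence "(\<Sum>k<n. (cmod (Z $$ (k,j)))\<^sup>2) = (s j)\<^sup>2" using of_real_eq_iff by blast
    moreover have "(cmod (Z $$ (k,j)))\<^sup>2 \<le> (\<Sum>k<n. (cmod (Z $$ (k,j)))\<^sup>2)"
      using k by (intro member_le_sum) auto
    ultimately show ?thesis using power2_le_imp_le[OF _ s] by simp
  qed
  have Fb: "cmod (F $$ (k,l)) \<le> q" and Gb: "cmod (G $$ (k,l)) \<le> q" if "k < n" "l < n" for k l
    using F G that by (auto simp: norm_bound_def)
  have "?D * U = G * Z" unfolding G(3) Z_def using G Y U by (simp add: assoc)
  hence "(?D * U) $$ (i,j) = (\<Sum>k<n. G $$ (i,k) * Z $$ (k,j))" by (simp only: index_mult_sum[OF G(1) Z i j])
  hence "complex_of_real (\<delta> i) * U $$ (i,j) = (\<Sum>k<n. G $$ (i,k) * Z $$ (k,j))"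
    using i j by (simp add: mat_diag_mult_left[OF U(1)])
  hence "cmod (complex_of_real (\<delta> i) * U $$ (i,j)) = cmod (\<Sum>k<n. G $$ (i,k) * Z $$ (k,j))" by simp
  also have "\<dots> \<le> (\<Sum>k<n. q * s j)"
    by (rule sum_norm_le) (use Gb Zb i j q s in \<open>auto simp: norm_mult intro!: mult_mono\<close>)
  finally show "\<delta> i * cmod (U $$ (i,j)) \<le> real n * q * s j" using \<delta>[OF i] by (simp add: norm_mult)
  have ZF: "mat_adjoint Z * F \<in> carrier_mat n n" using Z F by (simp add: assoc)
  have "?S * mat_adjoint U = mat_adjoint Z * F * ?D" unfolding SU F(3) using Z F by (simp add: assoc)
  hence "(?S * mat_adjoint U) $$ (j,i) = (mat_adjoint Z * F * ?D) $$ (j,i)" by simp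
  hence "complex_of_real ((s j)\<^sup>2) * cnj (U $$ (i,j)) = (\<Sum>k<n. cnj (Z $$ (k,j)) * F $$ (k,i)) * complex_of_real (\<delta> i)"
    using i j U Z unfolding mat_diag_mult_left[OF U(2)] mat_diag_mult_right[OF ZF]
    by (simp add: index_mult_sum[OF adjoint_carrier[OF Z] F(1) j i] del: index_mult_mat(1))
  hence "cmod (complex_of_real ((s j)\<^sup>2) * cnj (U $$ (i,j)))
      = cmod (\<Sum>k<n. cnj (Z $$ (k,j)) * F $$ (k,i)) * \<delta> i" using \<delta>[OF i] by (simp add: norm_mult)
  also have "cmod (\<Sum>k<n. cnj (Z $$ (k,j)) * F $$ (k,i)) \<le> (\<Sum>k<n. s j * q)"
    by (rule sum_norm_le) (use Fb Zb i j q s in \<open>auto simp: norm_mult intro!: mult_mono\<close>)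
  \<comment> \<open>The extra factor \<open>s j\<close>, due to the column of \<open>Z\<close>, is
    cancelled; if \<open>s j = 0\<close>, the bound is immediate.\<close>
  finally have "s j * (s j * cmod (U $$ (i,j))) \<le> s j * (real n * q * \<delta> i)"
    using \<delta>[OF i] s[of j] by (simp add: norm_mult power2_eq_square mult_right_mono mult_ac)
  moreover have "0 \<le> real n * q * \<delta> i" using q \<delta>[OF i] by simp
  ultimately show "s j * cmod (U $$ (i,j)) \<le> real n * q * \<delta> i"
    using s[of j] by (cases "s j = 0") auto
qed

section \<open>Growth of matrix powers and the hyperbolic element\<close>

lemma norm_bound_mono: "norm_bound A b \<Longrightarrow> b \<le> c \<Longrightarrow> norm_bound A c"
  unfolding norm_bound_def by force

lemma norm_bound_exists: "\<exists>c\<ge>0. norm_bound A c"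
proof -
  obtain b where "norm_bound A b" using norm_bound_max by blast
  hence "norm_bound A (max b 0)" by (rule norm_bound_mono) simp
  thus ?thesis by (intro exI[of _ "max b 0"]) simp
qed

text \<open>Each further factor pushes the support one diagonal up:
  \<open>(N ^\<^sub>m k) $$ (i,j)\<close> vanishes for \<open>j < i + k\<close>.\<close>

lemma strict_upper_triangular_pow_eq_0:
  fixes N :: "'a :: comm_ring_1 mat"
  assumes N: "N \<in> carrier_mat n n" and z: "\<And>i j. i < n \<Longrightarrow> j < n \<Longrightarrow> j \<le> i \<Longrightarrow> N $$ (i,j) = 0"
    and m: "n \<le> m"
  shows "N ^\<^sub>m m = 0\<^sub>m n n"
proof -
  have key: "(N ^\<^sub>m k) $$ (i,j) = 0" if "i < n" "j < n" "j < i + k" for i j k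
    using that
  proof (induction k arbitrary: i j)
    case 0
    thus ?case using N by simp
  next
    case (Suc k)
    have "(N ^\<^sub>m k * N) $$ (i,j) = (\<Sum>l<n. (N ^\<^sub>m k) $$ (i,l) * N $$ (l,j))"
      by (rule index_mult_sum[OF pow_carrier_mat[OF N] N Suc.prems(1,2)])
    also have "\<dots> = 0"
    proof (rule sum.neutral, intro ballI)
      fix l assume "l \<in> {..<n}"
      thus "(N ^\<^sub>m k) $$ (i,l) * N $$ (l,j) = 0"
        using Suc.IH[of i l] z[of l j] Suc.prems by (cases "l < i + k") auto
    qed
    finally show ?case by simp
  qed
  show ?thesis
    by (rule eq_matI) (use N m key in auto)
qed

lemma upper_triangular_eigenvalue:
  fixes T :: "'a :: field mat"
  assumes T: "T \<in> carrier_mat n n" "upper_triangular T" and ev: "eigenvalue T e"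
  shows "\<exists>i<n. T $$ (i,i) = e"
proof -
  have "poly (char_poly T) e = 0" using ev eigenvalue_root_char_poly[OF T(1)] by simp
  hence "(\<Prod>a\<leftarrow>diag_mat T. e - a) = 0"
    unfolding char_poly_upper_triangular[OF T] by (simp add: poly_prod_list o_def)
  hence "e \<in> set (diag_mat T)" by (auto simp: prod_list_zero_iff)
  thus ?thesis using T by (auto simp: diag_mat_def)
qed

text \<open>With spectral radius at most 1 the powers grow at most like a polynomial of degree
  \<open>n - 1\<close>. The weaker shape \<open>c * (1 + real k ^ n)\<close> has a single constant,
  so products of such bounds with constants keep it.\<close>

lemma norm_bound_pow_of_spectrum:
  fixes T :: "complex mat"
  assumes T: "T \<in> carrier_mat n n" and ev: "\<And>e. eigenvalue T e \<Longrightarrow> cmod e \<le> 1"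
  shows "\<exists>c\<ge>0. \<forall>k. norm_bound (T ^\<^sub>m k) (c * (1 + real k ^ n))"
proof (cases "n = 0")
  case True
  thus ?thesis using T by (intro exI[of _ 0]) (auto simp: norm_bound_def)
next
  case False
  have "spectral_radius T \<le> 1"
    using spectral_radius_mem_max(1)[OF T] False ev by (auto simp: spectrum_def)
  from spectral_radius_jnf_norm_bound_le_1_upper_triangular[OF T this]
  obtain c1 c2 where c: "\<And>k. norm_bound (T ^\<^sub>m k) (c1 + c2 * real k ^ (n - 1))" by auto
  define c where "c = \<bar>c1\<bar> + \<bar>c2\<bar>"
  have "c1 + c2 * real k ^ (n - 1) \<le> c * (1 + real k ^ n)" for k
  proof -
    \<comment> \<open>The summand 1 covers \<open>k = 0\<close> with \<open>n = 1\<close>, where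
      \<open>0 ^ 0 = 1\<close>.\<close>
    have "real k ^ (n - 1) \<le> 1 + real k ^ n"
    proof (cases "k = 0")
      case True
      thus ?thesis by (simp add: power_0_left)
    next
      case False
      hence "real k ^ (n - 1) \<le> real k ^ n" by (intro power_increasing) auto
      thus ?thesis by simp
    qed
    hence "c2 * real k ^ (n - 1) \<le> \<bar>c2\<bar> * (1 + real k ^ n)" by (intro mult_mono) auto
    moreover have "c1 \<le> \<bar>c1\<bar> * (1 + real k ^ n)"
      using mult_left_mono[of 1 "1 + real k ^ n" "\<bar>c1\<bar>"] by simp
    ultimately show ?thesis by (simp add: c_def distrib_right)
  qed
  hence "norm_bound (T ^\<^sub>m k) (c * (1 + real k ^ n))" for k by (rule norm_bound_mono[OF c])
  moreover have "0 \<le> c" by (simp add: c_def)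
  ultimately show ?thesis by blast
qed

text \<open>On the nonsingular blocks \<open>T\<close> is \<open>J\<close> divided by the moduli of its eigenvalues; the nilpotent
  blocks, which vanish in \<open>J ^\<^sub>m m\<close> for \<open>m \<ge> n\<close>, are replaced by the identity.\<close>

lemma modulus_factorization:
  fixes J :: "complex mat" and \<delta> :: "nat \<Rightarrow> real"
  assumes J: "J \<in> carrier_mat n n" "upper_triangular J"
    and diag: "\<And>i. i < n \<Longrightarrow> cmod (J $$ (i,i)) = \<delta> i"
    and comm: "\<And>i j. i < n \<Longrightarrow> j < n \<Longrightarrow> J $$ (i,j) \<noteq> 0 \<Longrightarrow> \<delta> i = \<delta> j"
  shows "\<exists>T Ti. T \<in> carrier_mat n n \<and> Ti \<in> carrier_mat n n \<and> T * Ti = 1\<^sub>m n \<and> Ti * T = 1\<^sub>m n \<and>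
    (\<forall>e. eigenvalue T e \<longrightarrow> cmod e = 1) \<and> (\<forall>e. eigenvalue Ti e \<longrightarrow> cmod e = 1) \<and>
    (\<forall>m\<ge>n. J ^\<^sub>m m = T ^\<^sub>m m * mat_diag n (\<lambda>i. complex_of_real (\<delta> i ^ m)))"
proof -
  note assoc = assoc_mult_mat[of _ n n _ n _ n] mult_carrier_mat[of _ n n _ n]
  define T where "T = mat n n (\<lambda>(i,j). if \<delta> j = 0 then if i = j then 1 else 0 else J $$ (i,j) / complex_of_real (\<delta> j))"
  define N where "N = mat n n (\<lambda>(i,j). if \<delta> j = 0 then J $$ (i,j) else 0)"
  let ?D = "mat_diag n (\<lambda>i. complex_of_real (\<delta> i))"
  have T: "T \<in> carrier_mat n n" and N: "N \<in> carrier_mat n n" by (auto simp: T_def N_def)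
  have Tix: "T $$ (i,j) = (if \<delta> j = 0 then if i = j then 1 else 0 else J $$ (i,j) / complex_of_real (\<delta> j))"
    and Nix: "N $$ (i,j) = (if \<delta> j = 0 then J $$ (i,j) else 0)" if "i < n" "j < n" for i j
    using that by (auto simp: T_def N_def)
  have ut: "upper_triangular T"
    using J by (auto simp: T_def upper_triangular_def)
  have Td: "cmod (T $$ (i,i)) = 1" if "i < n" for i
    using that diag[OF that, symmetric] by (auto simp: T_def norm_divide)
  have evT: "cmod e = 1" if "eigenvalue T e" for e
    using upper_triangular_eigenvalue[OF T ut that] Td by auto
  have "det T \<noteq> 0"
    unfolding det_upper_triangular[OF ut T] using T Td by (force simp: prod_list_zero_iff diag_mat_def)
  then obtain Ti where Ti: "Ti \<in> carrier_mat n n" "T * Ti = 1\<^sub>m n" "Ti * T = 1\<^sub>m n"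
    using det_non_zero_imp_unit[OF T, of "()"] by (auto simp: Units_def ring_mat_def)
  \<comment> \<open>Eigenvalues of the inverse are reciprocals of eigenvalues of \<open>T\<close>,
    with the same eigenvectors.\<close>
  have evTi: "cmod e = 1" if ev: "eigenvalue Ti e" for e
  proof -
    from ev Ti obtain v where v: "v \<in> carrier_vec n" "v \<noteq> 0\<^sub>v n" "Ti *\<^sub>v v = e \<cdot>\<^sub>v v"
      by (auto simp: eigenvalue_def eigenvector_def)
    have "v = T *\<^sub>v (Ti *\<^sub>v v)" using assoc_mult_mat_vec[OF T Ti(1) v(1)] v(1) Ti(2) by simp
    also have "\<dots> = e \<cdot>\<^sub>v (T *\<^sub>v v)" unfolding v(3) by (rule mult_mat_vec[OF T v(1)])
    finally have veq: "v = e \<cdot>\<^sub>v (T *\<^sub>v v)" .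
    have e: "e \<noteq> 0"
    proof
      assume "e = 0"
      hence "v = 0\<^sub>v n" by (subst veq, intro eq_vecI) (use T in auto)
      thus False using v by simp
    qed
    have "T *\<^sub>v v = (1 / e) \<cdot>\<^sub>v (e \<cdot>\<^sub>v (T *\<^sub>v v))" using e by (simp add: smult_smult_assoc)
    hence "T *\<^sub>v v = (1 / e) \<cdot>\<^sub>v v" using veq by simp
    hence "eigenvalue T (1 / e)" using T v by (auto simp: eigenvalue_def eigenvector_def)
    from evT[OF this] show ?thesis by (simp add: norm_divide)
  qed
  \<comment> \<open>\<open>T * ?D\<close> carries the columns with nonzero \<open>\<delta>\<close>,
    and \<open>N\<close> the others. As \<open>J\<close> couples only indices of equal modulus,
    \<open>?D\<close> commutes with \<open>T\<close> and annihilates \<open>N\<close> from both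
    sides.\<close>
  have TDN: "T * ?D + N = J"
    by (rule eq_matI) (use J T N in \<open>auto simp: mat_diag_mult_right[OF T] Tix Nix\<close>)
  have comm': "J $$ (i,j) = 0 \<or> \<delta> i = \<delta> j" if "i < n" "j < n" for i j
    using comm that by blast
  have TD: "T * ?D = ?D * T"
    using T comm' by (fastforce simp: mat_diag_mult_right[OF T] mat_diag_mult_left[OF T] Tix intro!: eq_matI)
  have DN: "?D * N = 0\<^sub>m n n"
    using N comm' by (fastforce simp: mat_diag_mult_left[OF N] Nix intro!: eq_matI)
  have ND: "N * ?D = 0\<^sub>m n n"
    using N by (auto simp: mat_diag_mult_right[OF N] Nix intro!: eq_matI)
  have D: "?D ^\<^sub>m m = mat_diag n (\<lambda>i. complex_of_real (\<delta> i ^ m))" for m by (simp add: mat_diag_pow)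
  have TDm: "?D ^\<^sub>m m * T = T * ?D ^\<^sub>m m" for m
    unfolding D using T comm'
    by (fastforce simp: mat_diag_mult_right[OF T] mat_diag_mult_left[OF T] Tix intro!: eq_matI)
  \<comment> \<open>The cross terms vanish, so powers split. The relation starts at exponent 1,
    because at exponent 0 the right side would be twice the identity.\<close>
  have pw: "J ^\<^sub>m Suc m = T ^\<^sub>m Suc m * ?D ^\<^sub>m Suc m + N ^\<^sub>m Suc m" for m
  proof (induction m)
    case 0
    show ?case using T N TDN by simp
  next
    case (Suc m)
    have P: "T ^\<^sub>m Suc m \<in> carrier_mat n n" "?D ^\<^sub>m Suc m \<in> carrier_mat n n" "N ^\<^sub>m Suc m \<in> carrier_mat n n"
      "?D ^\<^sub>m m \<in> carrier_mat n n" "N ^\<^sub>m m \<in> carrier_mat n n"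
      using T N by (auto intro!: pow_carrier_mat simp del: pow_mat.simps)
    have TDc: "T * ?D \<in> carrier_mat n n" using T by (simp add: assoc)
    have PD: "T ^\<^sub>m Suc m * ?D ^\<^sub>m Suc m \<in> carrier_mat n n" using mult_carrier_mat[OF P(1,2)] .
    have "J ^\<^sub>m Suc (Suc m) = (T ^\<^sub>m Suc m * ?D ^\<^sub>m Suc m + N ^\<^sub>m Suc m) * (T * ?D + N)"
      using Suc TDN by simp
    also have "\<dots> = (T ^\<^sub>m Suc m * ?D ^\<^sub>m Suc m) * (T * ?D) + N ^\<^sub>m Suc m * (T * ?D)
        + ((T ^\<^sub>m Suc m * ?D ^\<^sub>m Suc m) * N + N ^\<^sub>m Suc m * N)"
      using PD P TDc N
      by (simp add: add_mult_distrib_mat[of _ n n _ _ n] mult_add_distrib_mat[of _ n n _ n] del: pow_mat.simps)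
    also have "(T ^\<^sub>m Suc m * ?D ^\<^sub>m Suc m) * (T * ?D) = T ^\<^sub>m Suc m * (?D ^\<^sub>m Suc m * T) * ?D"
      using P T by (simp add: assoc del: pow_mat.simps)
    also have "\<dots> = T ^\<^sub>m Suc (Suc m) * ?D ^\<^sub>m Suc (Suc m)"
      unfolding TDm using P T by (simp add: assoc pow_mat.simps(2)[of _ "Suc m"] del: pow_mat.simps)
    also have "(T ^\<^sub>m Suc m * ?D ^\<^sub>m Suc m) * N = (T ^\<^sub>m Suc m * ?D ^\<^sub>m m) * (?D * N)"
      using P N by (simp add: assoc pow_mat.simps(2)[of "mat_diag _ _" m] del: pow_mat.simps)
    also have "\<dots> = 0\<^sub>m n n" unfolding DN by (rule right_mult_zero_mat[OF mult_carrier_mat[OF P(1,4)]])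
    also have "N ^\<^sub>m Suc m * (T * ?D) = (N ^\<^sub>m m * (N * ?D)) * T"
      unfolding TD using P N T by (simp add: assoc pow_mat.simps(2)[of _ m] del: pow_mat.simps)
    also have "\<dots> = 0\<^sub>m n n" unfolding ND using P T by (simp add: right_mult_zero_mat[of _ n n] left_mult_zero_mat[of _ n n])
    also have "N ^\<^sub>m Suc m * N = N ^\<^sub>m Suc (Suc m)" by simp
    finally show ?case
      using mult_carrier_mat[OF pow_carrier_mat[OF T] pow_carrier_mat[OF mat_diag_dim], of "Suc (Suc m)"]
        pow_carrier_mat[OF N, of "Suc (Suc m)"] by (simp del: pow_mat.simps)
  qed
  have pw_ge: "J ^\<^sub>m m = T ^\<^sub>m m * mat_diag n (\<lambda>i. complex_of_real (\<delta> i ^ m))" if m: "n \<le> m" for m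
  proof (cases m)
    case 0
    thus ?thesis using m J T by (intro eq_matI) auto
  next
    case (Suc k)
    \<comment> \<open>A diagonal entry of \<open>N\<close> is either 0 by definition or an entry of
      \<open>J\<close> of modulus \<open>\<delta> i = 0\<close>; hence \<open>N\<close> is strictly
      upper triangular.\<close>
    have "N $$ (i,j) = 0" if "i < n" "j < n" "j \<le> i" for i j
      using that J diag[of i] by (cases "i = j") (auto simp: Nix)
    from strict_upper_triangular_pow_eq_0[OF N this m]
    have "J ^\<^sub>m m = T ^\<^sub>m m * ?D ^\<^sub>m m + 0\<^sub>m n n" using pw[of k] Suc by simp
    also have "\<dots> = T ^\<^sub>m m * ?D ^\<^sub>m m"
      by (rule right_add_zero_mat[OF mult_carrier_mat[OF pow_carrier_mat[OF T] pow_carrier_mat[OF mat_diag_dim]]])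
    finally show ?thesis by (simp add: D)
  qed
  show ?thesis by (intro exI[of _ T] exI[of _ Ti] conjI allI impI T Ti evT evTi pw_ge)
qed

section \<open>Jordan forms and the diagonal of moduli\<close>

text \<open>Exactly the hypotheses of \<open>modulus_factorization\<close>. They are stable under
  direct sums, so they can be checked one eigenvalue at a time. The last condition says that
  \<open>J\<close> commutes with the diagonal matrix of the moduli.\<close>

definition modulus_block :: "nat \<Rightarrow> complex mat \<Rightarrow> (nat \<Rightarrow> real) \<Rightarrow> bool" where
  "modulus_block n J \<delta> \<longleftrightarrow> J \<in> carrier_mat n n \<and> upper_triangular J \<and>
     (\<forall>i<n. cmod (J $$ (i,i)) = \<delta> i) \<and> (\<forall>i<n. \<forall>j<n. J $$ (i,j) \<noteq> 0 \<longrightarrow> \<delta> i = \<delta> j)"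

lemma jordan_matrix_same_diag:
  "i < sum_list ss \<Longrightarrow> jordan_matrix (map (\<lambda>s. (s, \<mu>)) ss) $$ (i,i) = \<mu>"
  by (induction ss arbitrary: i) (auto simp: jordan_matrix_Cons o_def)

lemma modulus_block_jordan:
  "modulus_block (sum_list ss) (jordan_matrix (map (\<lambda>s. (s, \<mu>)) ss)) (\<lambda>_. cmod \<mu>)"
proof -
  have [simp]: "map (fst \<circ> (\<lambda>s. (s, \<mu>))) ss = ss" by (induction ss) auto
  show ?thesis
    using jordan_matrix_carrier[of "map (\<lambda>s. (s, \<mu>)) ss"]
      jordan_matrix_upper_triangular[of _ "map (\<lambda>s. (s, \<mu>)) ss"]
    by (auto simp: modulus_block_def jordan_matrix_same_diag upper_triangular_def)
qed

lemma modulus_block_four_block: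
  assumes "modulus_block n1 J1 \<delta>1" "modulus_block n2 J2 \<delta>2"
  shows "modulus_block (n1 + n2) (four_block_mat J1 (0\<^sub>m n1 n2) (0\<^sub>m n2 n1) J2)
    (\<lambda>i. if i < n1 then \<delta>1 i else \<delta>2 (i - n1))"
  unfolding modulus_block_def
proof (intro conjI allI impI)
  note a = assms[unfolded modulus_block_def]
  show "four_block_mat J1 (0\<^sub>m n1 n2) (0\<^sub>m n2 n1) J2 \<in> carrier_mat (n1 + n2) (n1 + n2)" using a by auto
  show "upper_triangular (four_block_mat J1 (0\<^sub>m n1 n2) (0\<^sub>m n2 n1) J2)"
    using a by (intro upper_triangular_four_block) auto
qed (use assms in \<open>auto simp: modulus_block_def split: if_splits\<close>)

lemma mat_diag_four_block:
  "four_block_mat (mat_diag n1 f) (0\<^sub>m n1 n2) (0\<^sub>m n2 n1) (mat_diag n2 g)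
    = mat_diag (n1 + n2) (\<lambda>i. if i < n1 then f i else g (i - n1))"
  by (rule eq_matI) (auto simp: mat_diag_def)

text \<open>The same \<open>\<delta>\<close> has to describe both block sums, so a single induction
  over the eigenvalues builds it for the two together.\<close>

lemma diag_block_mat_modulus:
  fixes sizes :: "complex \<Rightarrow> nat list"
  shows "\<exists>n \<delta>. modulus_block n (diag_block_mat (map (\<lambda>\<mu>. jordan_matrix (map (\<lambda>s. (s, \<mu>)) (sizes \<mu>))) mus)) \<delta> \<and>
    diag_block_mat (map (\<lambda>\<mu>. complex_of_real (cmod \<mu>) \<cdot>\<^sub>m 1\<^sub>m (sum_list (sizes \<mu>))) mus)
      = mat_diag n (\<lambda>i. complex_of_real (\<delta> i))"
proof (induction mus)
  case Nil
  show ?case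
    by (rule exI[of _ 0], rule exI[of _ "\<lambda>_. 0"]) (auto simp: modulus_block_def mat_diag_def)
next
  case (Cons \<mu> mus)
  let ?J = "jordan_matrix (map (\<lambda>s. (s, \<mu>)) (sizes \<mu>))" and ?k = "sum_list (sizes \<mu>)"
  let ?Js = "diag_block_mat (map (\<lambda>\<mu>. jordan_matrix (map (\<lambda>s. (s, \<mu>)) (sizes \<mu>))) mus)"
  obtain n \<delta> where IH: "modulus_block n ?Js \<delta>"
    "diag_block_mat (map (\<lambda>\<mu>. complex_of_real (cmod \<mu>) \<cdot>\<^sub>m 1\<^sub>m (sum_list (sizes \<mu>))) mus)
      = mat_diag n (\<lambda>i. complex_of_real (\<delta> i))"
    using Cons by blast
  note J = modulus_block_jordan[of "sizes \<mu>" \<mu>]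
  have one: "complex_of_real (cmod \<mu>) \<cdot>\<^sub>m 1\<^sub>m ?k = mat_diag ?k (\<lambda>_. complex_of_real (cmod \<mu>))"
    by (rule eq_matI) (auto simp: mat_diag_def)
  have d: "dim_row ?J = ?k" "dim_col ?J = ?k" "dim_row ?Js = n" "dim_col ?Js = n"
    using J IH(1) unfolding modulus_block_def by (auto simp del: jordan_matrix_dim)
  have d': "dim_row (mat_diag k f) = k" "dim_col (mat_diag k f) = k" for k and f :: "nat \<Rightarrow> complex"
    by (auto simp: mat_diag_def)
  have "diag_block_mat (map (\<lambda>\<mu>. complex_of_real (cmod \<mu>) \<cdot>\<^sub>m 1\<^sub>m (sum_list (sizes \<mu>))) (\<mu> # mus))
    = mat_diag (?k + n) (\<lambda>i. complex_of_real (if i < ?k then cmod \<mu> else \<delta> (i - ?k)))"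
    by (simp add: IH(2) one Let_def d' mat_diag_four_block if_distrib)
  moreover have "diag_block_mat (map (\<lambda>\<mu>. jordan_matrix (map (\<lambda>s. (s, \<mu>)) (sizes \<mu>))) (\<mu> # mus))
    = four_block_mat ?J (0\<^sub>m ?k n) (0\<^sub>m n ?k) ?Js"
    by (simp add: Let_def d del: jordan_matrix_dim)
  ultimately show ?case
    using modulus_block_four_block[OF J IH(1)]
    by (intro exI[of _ "?k + n"] exI[of _ "\<lambda>i. if i < ?k then cmod \<mu> else \<delta> (i - ?k)"]) (simp only: simp_thms)
qed

lemma order_prod_list_linear_powers:
  fixes mus :: "'a :: field list"
  assumes "distinct mus"
  shows "Polynomial.order \<mu> (\<Prod>\<nu>\<leftarrow>mus. [:- \<nu>, 1:] ^ k \<nu>) = (if \<mu> \<in> set mus then k \<mu> else 0)"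
  using assms
proof (induction mus)
  case (Cons \<nu> mus)
  have nz: "(\<Prod>\<nu>\<leftarrow>xs. [:- \<nu>, 1:] ^ k \<nu>) \<noteq> 0" for xs :: "'a list"
    by (auto simp: prod_list_zero_iff)
  have "Polynomial.order \<mu> ([:- \<nu>, 1:] ^ k \<nu>) = (if \<mu> = \<nu> then k \<nu> else 0)"
    by (auto simp: order_power_n_n intro!: order_0I)
  thus ?case using Cons nz[of "\<nu> # mus"] by (auto simp: order_mult)
qed (auto intro: order_0I)

text \<open>The direct sum of direct sums is flattened into one Jordan matrix; the blocks of one
  eigenvalue then contribute a power whose exponent is the sum of their sizes.\<close>

lemma char_poly_jordan_sizes:
  fixes mus :: "complex list"
  shows "char_poly (diag_block_mat (map (\<lambda>\<mu>. jordan_matrix (map (\<lambda>s. (s, \<mu>)) (sizes \<mu>))) mus))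
    = (\<Prod>\<mu>\<leftarrow>mus. [:- \<mu>, 1:] ^ sum_list (sizes \<mu> :: nat list))"
proof -
  have pl: "(\<Prod>s\<leftarrow>ss. [:- \<mu>, 1:] ^ s) = [:- \<mu>, 1:] ^ sum_list ss" for \<mu> :: complex and ss :: "nat list"
    by (induction ss) (auto simp: power_add)
  have "(\<Prod>(s, \<mu>)\<leftarrow>concat (map (\<lambda>\<mu>. map (\<lambda>s. (s, \<mu>)) (sizes \<mu>)) mus). [:- \<mu>, 1:] ^ s)
      = (\<Prod>\<mu>\<leftarrow>mus. [:- \<mu>, 1:] ^ sum_list (sizes \<mu>))"
    by (induction mus) (simp_all add: o_def pl)
  moreover have "diag_block_mat (map (\<lambda>\<mu>. jordan_matrix (map (\<lambda>s. (s, \<mu>)) (sizes \<mu>))) mus)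
      = jordan_matrix (concat (map (\<lambda>\<mu>. map (\<lambda>s. (s, \<mu>)) (sizes \<mu>)) mus))"
    by (simp add: jordan_matrix_concat_diag_block_mat o_def)
  ultimately show ?thesis
    by (simp add: jordan_matrix_char_poly)
qed

text \<open>In the hyperbolic element the scalar blocks are sized by algebraic multiplicity, in the
  Jordan form by the sizes of Jordan blocks. Comparing characteristic polynomials shows that these
  agree, so the two block structures match and \<open>H\<close> is diagonal in the same
  basis.\<close>

lemma hyperbolic_element_modulus_block:
  assumes A: "A \<in> carrier_mat n n" and hyp: "hyperbolic_element A H"
  obtains J \<delta> M0 N0 where "modulus_block n J \<delta>" "similar_mat_wit A J M0 N0"
    "H = M0 * mat_diag n (\<lambda>i. complex_of_real (\<delta> i)) * N0"
proof -
  from hyp obtain mus sizes M0 N0 where mus: "distinct mus"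
    and sim: "similar_mat_wit A (diag_block_mat (map (\<lambda>\<mu>. jordan_matrix (map (\<lambda>s. (s, \<mu>)) (sizes \<mu>))) mus)) M0 N0"
    and H: "H = M0 * diag_block_mat (map (\<lambda>\<mu>. complex_of_real (cmod \<mu>) \<cdot>\<^sub>m 1\<^sub>m (Polynomial.order \<mu> (char_poly A))) mus) * N0"
    unfolding hyperbolic_element_def Let_def by auto
  let ?J = "diag_block_mat (map (\<lambda>\<mu>. jordan_matrix (map (\<lambda>s. (s, \<mu>)) (sizes \<mu>))) mus)"
  have "char_poly A = char_poly ?J"
    by (rule char_poly_similar) (use sim in \<open>auto simp: similar_mat_def\<close>)
  hence "Polynomial.order \<mu> (char_poly A) = sum_list (sizes \<mu>)" if "\<mu> \<in> set mus" for \<mu>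
    using that order_prod_list_linear_powers[OF mus, of \<mu> "\<lambda>\<mu>. sum_list (sizes \<mu>)"]
    by (simp add: char_poly_jordan_sizes)
  hence eq: "map (\<lambda>\<mu>. complex_of_real (cmod \<mu>) \<cdot>\<^sub>m 1\<^sub>m (Polynomial.order \<mu> (char_poly A))) mus
      = map (\<lambda>\<mu>. complex_of_real (cmod \<mu>) \<cdot>\<^sub>m (1\<^sub>m (sum_list (sizes \<mu>)) :: complex mat)) mus"
    by simp
  obtain k \<delta> where k: "modulus_block k ?J \<delta>"
    and D: "diag_block_mat (map (\<lambda>\<mu>. complex_of_real (cmod \<mu>) \<cdot>\<^sub>m 1\<^sub>m (sum_list (sizes \<mu>))) mus)
      = mat_diag k (\<lambda>i. complex_of_real (\<delta> i))"
    using diag_block_mat_modulus[of sizes mus] by blast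
  have kn: "k = n" using k similar_mat_witD2(5)[OF A sim] by (auto simp: modulus_block_def)
  show ?thesis
  proof (rule that[OF _ sim])
    show "modulus_block n ?J \<delta>" using k kn by simp
    show "H = M0 * mat_diag n (\<lambda>i. complex_of_real (\<delta> i)) * N0" unfolding H eq D kn ..
  qed
qed

section \<open>Triangular factors\<close>

lemma GL_inverse:
  assumes "X \<in> GL n"
  obtains Xi where "X \<in> carrier_mat n n" "Xi \<in> carrier_mat n n" "X * Xi = 1\<^sub>m n" "Xi * X = 1\<^sub>m n"
proof -
  from assms obtain Xi where X: "X \<in> carrier_mat n n" and inv: "inverts_mat X Xi" "inverts_mat Xi X"
    unfolding GL_def invertible_mat_def by auto
  have 1: "X * Xi = 1\<^sub>m n" and 2: "Xi * X = 1\<^sub>m (dim_row Xi)" using inv X by (auto simp: inverts_mat_def)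
  have "dim_col Xi = n" using arg_cong[OF 1, of dim_col] by simp
  moreover have "dim_row Xi = n" using arg_cong[OF 2, of dim_col] X by simp
  ultimately show ?thesis using that[of Xi] X 1 2 by auto
qed

text \<open>Forward substitution: once the earlier rows of \<open>Li\<close> are known to vanish
  right of the diagonal, entry \<open>(i,j)\<close> of \<open>L * Li = 1\<close> reduces to
  \<open>L $$ (i,i) * Li $$ (i,j) = 0\<close>, and the diagonal of \<open>L\<close> has no
  zeros.\<close>

lemma lower_triangular_inverse:
  fixes L Li :: "'a :: field mat"
  assumes L: "L \<in> carrier_mat n n" "lower_triangular L" and Li: "Li \<in> carrier_mat n n" and inv: "L * Li = 1\<^sub>m n"
  shows "lower_triangular Li"
proof -
  have "det L * det Li = 1" using det_mult[OF L(1) Li] inv by simp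
  hence "det L \<noteq> 0" by auto
  hence "prod_list (diag_mat L) \<noteq> 0"
    using det_lower_triangular[of n L] L by (auto simp: lower_triangular_def)
  hence d: "L $$ (i,i) \<noteq> 0" if "i < n" for i
    using that L by (auto simp: prod_list_zero_iff diag_mat_def)
  have "Li $$ (i,j) = 0" if "i < j" "j < n" for i j
    using that
  proof (induction i rule: less_induct)
    case (less i)
    have i: "i < n" using less.prems by simp
    have "0 = (L * Li) $$ (i,j)" using inv less.prems by simp
    also have "\<dots> = (\<Sum>k<n. L $$ (i,k) * Li $$ (k,j))"
      by (rule index_mult_sum[OF L(1) Li i less.prems(2)])
    also have "\<dots> = (\<Sum>k<n. if k = i then L $$ (i,i) * Li $$ (i,j) else 0)"
    proof (rule sum.cong)
      fix k assume "k \<in> {..<n}"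
      moreover have "L $$ (i,k) = 0" if "i < k" "k < n" using that L i by (auto simp: lower_triangular_def)
      moreover have "Li $$ (k,j) = 0" if "k < i" using less.IH[OF that] that less.prems by simp
      ultimately show "L $$ (i,k) * Li $$ (k,j) = (if k = i then L $$ (i,i) * Li $$ (i,j) else 0)"
        by (cases k i rule: linorder_cases) auto
    qed simp
    also have "\<dots> = L $$ (i,i) * Li $$ (i,j)" using i by simp
    finally show ?case using d[OF i] by simp
  qed
  thus ?thesis using Li by (auto simp: lower_triangular_def)
qed

text \<open>\<open>X\<close> plays the part of \<open>D\<^sup>m * L * D\<^sup>-\<^sup>m\<close>,
  with entries \<open>(d i / d j) ^ m * L $$ (i,j)\<close>. Only \<open>j \<le> i\<close> matters,
  where the quotient is at most 1, so the bound is uniform in \<open>m\<close>. Writing the relation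
  without an inverse admits zeros in \<open>d\<close>.\<close>

lemma lower_triangular_diag_commute:
  fixes L :: "complex mat" and d :: "nat \<Rightarrow> real"
  assumes L: "L \<in> carrier_mat n n" "lower_triangular L"
    and d0: "\<And>i. i < n \<Longrightarrow> 0 \<le> d i" and d: "\<And>i j. i \<le> j \<Longrightarrow> j < n \<Longrightarrow> d j \<le> d i"
  shows "\<exists>c\<ge>0. \<forall>m>0. \<exists>X \<in> carrier_mat n n. norm_bound X c \<and>
    mat_diag n (\<lambda>i. complex_of_real (d i ^ m)) * L = X * mat_diag n (\<lambda>i. complex_of_real (d i ^ m))"
proof -
  obtain c where c: "0 \<le> c" "norm_bound L c" using norm_bound_exists by blast
  have cL: "cmod (L $$ (i,j)) \<le> c" if "i < n" "j < n" for i j using c that L by (auto simp: norm_bound_def)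
  have Lz: "L $$ (i,j) = 0" if "i < j" "j < n" for i j using that L by (auto simp: lower_triangular_def)
  define Lm where "Lm m = mat n n (\<lambda>(i,j). complex_of_real ((d i / d j) ^ m) * L $$ (i,j))" for m :: nat
  have Lm: "Lm m \<in> carrier_mat n n" for m by (auto simp: Lm_def)
  have bound: "norm_bound (Lm m) c" for m
  proof
    fix i j assume "i < dim_row (Lm m)" "j < dim_col (Lm m)"
    hence ij: "i < n" "j < n" by (auto simp: Lm_def)
    show "cmod (Lm m $$ (i,j)) \<le> c"
    proof (cases "i < j")
      case True
      thus ?thesis using ij Lz c by (simp add: Lm_def)
    next
      case False
      \<comment> \<open>For \<open>d j = 0\<close> the quotient is 0 by convention.\<close>
      hence "d i / d j \<le> 1" using d[of j i] d0[of j] ij by (auto simp: divide_le_eq_1)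
      hence "(d i / d j) ^ m \<le> 1" using d0 ij by (intro power_le_one) auto
      moreover have "0 \<le> (d i / d j) ^ m" using d0 ij by simp
      ultimately have "\<bar>(d i / d j) ^ m\<bar> * cmod (L $$ (i,j)) \<le> 1 * c"
        using cL[OF ij] by (intro mult_mono) auto
      thus ?thesis using ij by (simp add: Lm_def norm_mult del: of_real_power)
    qed
  qed
  have comm: "mat_diag n (\<lambda>i. complex_of_real (d i ^ m)) * L = Lm m * mat_diag n (\<lambda>i. complex_of_real (d i ^ m))"
    if m: "m > 0" for m
  proof (rule eq_matI)
    fix i j assume "i < dim_row (Lm m * mat_diag n (\<lambda>i. complex_of_real (d i ^ m)))"
      "j < dim_col (Lm m * mat_diag n (\<lambda>i. complex_of_real (d i ^ m)))"
    hence ij: "i < n" "j < n" using carrier_matD[OF Lm[of m]] by (auto simp: mat_diag_def)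
    have "complex_of_real (d i ^ m) * L $$ (i,j)
        = complex_of_real ((d i / d j) ^ m) * L $$ (i,j) * complex_of_real (d j ^ m)"
    proof (cases "d j = 0")
      \<comment> \<open>On and below the diagonal \<open>d i \<le> d j = 0\<close>, and the left
        side vanishes since \<open>m > 0\<close>; above it \<open>L $$ (i,j) = 0\<close>.\<close>
      case True
      hence "i < j \<or> d i = 0" using d[of j i] d0[of i] ij by (cases "i < j") auto
      thus ?thesis using True Lz[of i j] ij m by auto
    next
      case False
      thus ?thesis by (simp add: power_divide)
    qed
    thus "(mat_diag n (\<lambda>i. complex_of_real (d i ^ m)) * L) $$ (i,j)
        = (Lm m * mat_diag n (\<lambda>i. complex_of_real (d i ^ m))) $$ (i,j)"
      unfolding mat_diag_mult_left[OF L(1)] mat_diag_mult_right[OF Lm] using ij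
      by (simp add: Lm_def)
  qed (use L carrier_matD[OF Lm[of m]] in \<open>auto simp: mat_diag_def\<close>)
  show ?thesis using c(1) Lm bound comm by meson
qed

section \<open>Matrix powers, unitary conjugation and entrywise limits\<close>

lemma pow_mat_Suc_left:
  assumes "A \<in> carrier_mat n n"
  shows "A ^\<^sub>m Suc k = A * A ^\<^sub>m k"
proof (induction k)
  case (Suc k)
  have "A ^\<^sub>m Suc (Suc k) = A * A ^\<^sub>m k * A" using Suc by simp
  also have "\<dots> = A * A ^\<^sub>m Suc k" using assoc_mult_mat[OF assms pow_carrier_mat[OF assms] assms] by simp
  finally show ?case .
qed (use assms in simp)

lemma pow_mat_inverse:
  assumes T: "T \<in> carrier_mat n n" "Ti \<in> carrier_mat n n" and inv: "Ti * T = 1\<^sub>m n"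
  shows "Ti ^\<^sub>m k * T ^\<^sub>m k = 1\<^sub>m n"
proof (induction k)
  case (Suc k)
  have P: "Ti ^\<^sub>m k \<in> carrier_mat n n" "T ^\<^sub>m k \<in> carrier_mat n n" using T by (auto intro: pow_carrier_mat)
  have "Ti ^\<^sub>m Suc k * T ^\<^sub>m Suc k = Ti ^\<^sub>m k * ((Ti * T) * T ^\<^sub>m k)"
    unfolding pow_mat_Suc_left[OF T(1)] using P T
    by (simp add: assoc_mult_mat[of _ n n _ n _ n] mult_carrier_mat[of _ n n _ n])
  thus ?case using Suc by (simp add: inv left_mult_one_mat[OF P(2)])
qed (use T in simp)

lemma spectral_mat_conj:
  assumes "V \<in> unitary_group n" "U \<in> unitary_group n"
  shows "V * spectral_mat n U d * mat_adjoint V = spectral_mat n (V * U) d"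
  using unitary_groupD(1,2)[OF assms(1)] unitary_groupD(1,2)[OF assms(2)]
  by (simp add: spectral_mat_def adjoint_mult[of _ n n _ n] assoc_mult_mat[of _ n n _ n _ n] mult_carrier_mat[of _ n n _ n])

lemma mat_LIMSEQ_cong:
  assumes "mat_LIMSEQ n X E" "\<forall>\<^sub>F m in sequentially. X m = Y m"
  shows "mat_LIMSEQ n Y E"
  unfolding mat_LIMSEQ_def
proof (intro conjI allI impI)
  show "\<forall>\<^sub>F m in sequentially. Y m \<in> carrier_mat n n"
    using assms unfolding mat_LIMSEQ_def by (auto elim: eventually_elim2)
  fix i j assume "i < n" "j < n"
  hence "(\<lambda>m. X m $$ (i,j)) \<longlonglongrightarrow> E $$ (i,j)" using assms(1) by (auto simp: mat_LIMSEQ_def)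
  thus "(\<lambda>m. Y m $$ (i,j)) \<longlonglongrightarrow> E $$ (i,j)"
    by (rule Lim_transform_eventually) (use assms(2) in \<open>auto elim: eventually_mono\<close>)
qed (use assms in \<open>simp add: mat_LIMSEQ_def\<close>)

lemma mat_LIMSEQ_unique:
  assumes "mat_LIMSEQ n X E" "mat_LIMSEQ n X E'"
  shows "E = E'"
proof (rule eq_matI)
  fix i j assume "i < dim_row E'" "j < dim_col E'"
  hence "(\<lambda>m. X m $$ (i,j)) \<longlonglongrightarrow> E $$ (i,j)" "(\<lambda>m. X m $$ (i,j)) \<longlonglongrightarrow> E' $$ (i,j)"
    using assms by (auto simp: mat_LIMSEQ_def)
  thus "E $$ (i,j) = E' $$ (i,j)" by (rule LIMSEQ_unique)
qed (use assms in \<open>auto simp: mat_LIMSEQ_def\<close>)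

lemma mat_LIMSEQ_mult:
  assumes X: "mat_LIMSEQ n X E" and P: "P \<in> carrier_mat n n" and R: "R \<in> carrier_mat n n"
  shows "mat_LIMSEQ n (\<lambda>m. P * X m * R) (P * E * R)"
proof -
  have E: "E \<in> carrier_mat n n" and Xc: "\<forall>\<^sub>F m in sequentially. X m \<in> carrier_mat n n"
    and lim: "\<And>i j. i < n \<Longrightarrow> j < n \<Longrightarrow> (\<lambda>m. X m $$ (i,j)) \<longlonglongrightarrow> E $$ (i,j)"
    using X by (auto simp: mat_LIMSEQ_def)
  have ix: "(P * Z * R) $$ (i,j) = (\<Sum>l<n. (\<Sum>k<n. P $$ (i,k) * Z $$ (k,l)) * R $$ (l,j))"
    if "i < n" "j < n" "Z \<in> carrier_mat n n" for i j Z
    unfolding index_mult_sum[OF mult_carrier_mat[OF P that(3)] R that(1,2)]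
    by (intro sum.cong) (auto simp: index_mult_sum[OF P that(3) that(1)] simp del: index_mult_mat(1))
  show ?thesis
    unfolding mat_LIMSEQ_def
  proof (intro conjI allI impI)
    show "P * E * R \<in> carrier_mat n n" using P E R by (simp add: mult_carrier_mat[of _ n n _ n])
    show "\<forall>\<^sub>F m in sequentially. P * X m * R \<in> carrier_mat n n"
      using Xc by eventually_elim (use P R in \<open>simp add: mult_carrier_mat[of _ n n _ n]\<close>)
    fix i j assume ij: "i < n" "j < n"
    have "(\<lambda>m. \<Sum>l<n. (\<Sum>k<n. P $$ (i,k) * X m $$ (k,l)) * R $$ (l,j))
        \<longlonglongrightarrow> (\<Sum>l<n. (\<Sum>k<n. P $$ (i,k) * E $$ (k,l)) * R $$ (l,j))"
      by (intro tendsto_sum tendsto_mult tendsto_const lim) (use ij in auto)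
    hence "(\<lambda>m. \<Sum>l<n. (\<Sum>k<n. P $$ (i,k) * X m $$ (k,l)) * R $$ (l,j)) \<longlonglongrightarrow> (P * E * R) $$ (i,j)"
      by (simp only: ix[OF ij E])
    moreover have "\<forall>\<^sub>F m in sequentially.
      (\<Sum>l<n. (\<Sum>k<n. P $$ (i,k) * X m $$ (k,l)) * R $$ (l,j)) = (P * X m * R) $$ (i,j)"
      using Xc by eventually_elim (simp only: ix[OF ij])
    ultimately show "(\<lambda>m. (P * X m * R) $$ (i,j)) \<longlonglongrightarrow> (P * E * R) $$ (i,j)"
      by (rule Lim_transform_eventually)
  qed
qed

lemma poly_times_geometric_tendsto_0:
  fixes \<rho> :: real
  assumes "0 \<le> \<rho>" "\<rho> < 1"
  shows "(\<lambda>m. K * (1 + real m ^ n) * \<rho> ^ m) \<longlonglongrightarrow> 0"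
proof -
  have g: "(\<lambda>m. \<rho> ^ m) \<longlonglongrightarrow> 0" using assms by (intro LIMSEQ_power_zero) auto
  have "(\<lambda>m. real m ^ n * \<rho> ^ m) \<longlonglongrightarrow> 0"
  proof (cases "n = 0")
    case False
    \<comment> \<open>With the \<open>n\<close>-th root of \<open>\<rho>\<close> the sequence is the
      \<open>n\<close>-th power of \<open>real m * \<sigma> ^ m\<close>, which tends to 0.\<close>
    define \<sigma> where "\<sigma> = root n \<rho>"
    have \<sigma>: "norm \<sigma> < 1" "\<sigma> ^ n = \<rho>" using assms False by (auto simp: \<sigma>_def)
    have "(\<lambda>m. (real m * \<sigma> ^ m) ^ n) \<longlonglongrightarrow> 0 ^ n"
      by (intro tendsto_power powser_times_n_limit_0 \<sigma>)
    moreover have "(real m * \<sigma> ^ m) ^ n = real m ^ n * \<rho> ^ m" for m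
      by (simp add: power_mult_distrib \<sigma>(2)[symmetric] power_mult[symmetric] mult.commute)
    ultimately show ?thesis using False by (simp add: power_0_left)
  qed (use g in simp)
  from tendsto_mult[OF tendsto_const tendsto_add[OF g this], of K] show ?thesis
    by (simp add: algebra_simps)
qed

section \<open>The limit\<close>

text \<open>With \<open>E\<close> the diagonal of \<open>\<delta>\<^sup>m\<close>,
  \<open>A\<^sup>m = M0 * T\<^sup>m * E * N0\<close>. The two diagonalizations of \<open>H\<close>
  replace \<open>E * N0\<close> by \<open>N0 * M * D\<^sup>m * Mi\<close>, then
  \<open>Mi * C * mat_adjoint Q\<close> becomes \<open>L\<close>, and \<open>L\<close> moves past
  \<open>D\<^sup>m\<close> at bounded cost. Apart from the powers of \<open>T\<close>, which grow
  polynomially, all factors collected in \<open>F\<close> are bounded in \<open>m\<close>;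
  \<open>G\<close> reverses these steps.\<close>

lemma power_factorization_bounds:
  fixes A C B M Mi L H Q :: "complex mat" and d :: "nat \<Rightarrow> real"
  assumes A: "A \<in> carrier_mat n n" and hyp: "hyperbolic_element A H"
    and C: "C \<in> carrier_mat n n" and B: "B \<in> GL n"
    and H: "similar_mat_wit H (mat_diag n (\<lambda>i. complex_of_real (d i))) M Mi"
    and L: "L \<in> GL n" "lower_triangular L" and Q: "Q \<in> unitary_group n" and LQ: "Mi * C = L * Q"
    and d0: "\<And>i. i < n \<Longrightarrow> 0 \<le> d i" and d: "\<And>i j. i \<le> j \<Longrightarrow> j < n \<Longrightarrow> d j \<le> d i"
  obtains K where "0 \<le> K" "\<And>m. n < m \<Longrightarrow> \<exists>F G. F \<in> carrier_mat n n \<and> G \<in> carrier_mat n n \<and>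
      norm_bound F (K * (1 + real m ^ n)) \<and> norm_bound G (K * (1 + real m ^ n)) \<and>
      B * A ^\<^sub>m m * C * mat_adjoint Q = F * mat_diag n (\<lambda>i. complex_of_real (d i ^ m)) \<and>
      mat_diag n (\<lambda>i. complex_of_real (d i ^ m)) = G * (B * A ^\<^sub>m m * C * mat_adjoint Q)"
proof -
  note assoc = assoc_mult_mat[of _ n n _ n _ n] mult_carrier_mat[of _ n n _ n]
  obtain J \<delta> M0 N0 where J: "modulus_block n J \<delta>" and simA: "similar_mat_wit A J M0 N0"
    and H0: "H = M0 * mat_diag n (\<lambda>i. complex_of_real (\<delta> i)) * N0"
    using hyperbolic_element_modulus_block[OF A hyp] .
  note a = similar_mat_witD2[OF A simA]
  note c0 = a(5-7)
  have Hc: "H \<in> carrier_mat n n" using H0 c0 by (simp add: assoc)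
  note h = similar_mat_witD2[OF Hc H]
  note Q' = unitary_groupD[OF Q]
  obtain Bi where Bi: "B \<in> carrier_mat n n" "Bi \<in> carrier_mat n n" "Bi * B = 1\<^sub>m n" using GL_inverse[OF B] .
  obtain Li where Li: "L \<in> carrier_mat n n" "Li \<in> carrier_mat n n" "L * Li = 1\<^sub>m n" "Li * L = 1\<^sub>m n"
    using GL_inverse[OF L(1)] .
  note Lilow = lower_triangular_inverse[OF Li(1) L(2) Li(2,3)]
  have Jb: "J \<in> carrier_mat n n" "upper_triangular J" "\<And>i. i < n \<Longrightarrow> cmod (J $$ (i,i)) = \<delta> i"
    "\<And>i j. i < n \<Longrightarrow> j < n \<Longrightarrow> J $$ (i,j) \<noteq> 0 \<Longrightarrow> \<delta> i = \<delta> j"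
    using J by (auto simp: modulus_block_def)
  obtain T Ti where T: "T \<in> carrier_mat n n" "Ti \<in> carrier_mat n n" "T * Ti = 1\<^sub>m n" "Ti * T = 1\<^sub>m n"
    and ev: "\<And>e. eigenvalue T e \<Longrightarrow> cmod e = 1" "\<And>e. eigenvalue Ti e \<Longrightarrow> cmod e = 1"
    and JT: "\<And>m. n \<le> m \<Longrightarrow> J ^\<^sub>m m = T ^\<^sub>m m * mat_diag n (\<lambda>i. complex_of_real (\<delta> i ^ m))"
    using modulus_factorization[OF Jb] by blast
  obtain cT where cT: "cT \<ge> 0" "\<And>k. norm_bound (T ^\<^sub>m k) (cT * (1 + real k ^ n))"
    using norm_bound_pow_of_spectrum[OF T(1) eq_refl[OF ev(1)]] by blast
  obtain cTi where cTi: "cTi \<ge> 0" "\<And>k. norm_bound (Ti ^\<^sub>m k) (cTi * (1 + real k ^ n))"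
    using norm_bound_pow_of_spectrum[OF T(2) eq_refl[OF ev(2)]] by blast
  obtain cL where cL: "0 \<le> cL" "\<And>m. m > 0 \<Longrightarrow> \<exists>X \<in> carrier_mat n n. norm_bound X cL \<and>
    mat_diag n (\<lambda>i. complex_of_real (d i ^ m)) * L = X * mat_diag n (\<lambda>i. complex_of_real (d i ^ m))"
    using lower_triangular_diag_commute[where d = d, OF Li(1) L(2) d0 d] by blast
  obtain cLi where cLi: "\<And>m. m > 0 \<Longrightarrow> \<exists>X \<in> carrier_mat n n. norm_bound X cLi \<and>
    mat_diag n (\<lambda>i. complex_of_real (d i ^ m)) * Li = X * mat_diag n (\<lambda>i. complex_of_real (d i ^ m))"
    using lower_triangular_diag_commute[where d = d, OF Li(2) Lilow d0 d] by blast
  define P1 where "P1 = B * M0"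
  define P2 where "P2 = N0 * M"
  define P3 where "P3 = Mi * M0"
  define P4 where "P4 = N0 * Bi"
  have P: "P1 \<in> carrier_mat n n" "P2 \<in> carrier_mat n n" "P3 \<in> carrier_mat n n" "P4 \<in> carrier_mat n n"
    using Bi h c0 by (auto simp: P1_def P2_def P3_def P4_def assoc)
  obtain b1 where b1: "0 \<le> b1" "norm_bound P1 b1" using norm_bound_exists by blast
  obtain b2 where b2: "0 \<le> b2" "norm_bound P2 b2" using norm_bound_exists by blast
  obtain b3 where b3: "norm_bound P3 b3" using norm_bound_exists by blast
  obtain b4 where b4: "norm_bound P4 b4" using norm_bound_exists by blast
  \<comment> \<open>Entrywise bounds multiply up to one factor \<open>n\<close> per matrix product;
    \<open>F\<close> and \<open>G\<close> each contain three products.\<close>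
  define K1 where "K1 = b1 * cT * real n * b2 * real n * cL * real n"
  define K2 where "K2 = cLi * b3 * real n * cTi * real n * b4 * real n"
  define K where "K = max K1 K2"
  have K0: "0 \<le> K" using b1(1) b2(1) cT(1) cL(1) by (auto simp: K_def K1_def intro!: max.coboundedI1)
  have "\<exists>F G. F \<in> carrier_mat n n \<and> G \<in> carrier_mat n n \<and>
      norm_bound F (K * (1 + real m ^ n)) \<and> norm_bound G (K * (1 + real m ^ n)) \<and>
      B * A ^\<^sub>m m * C * mat_adjoint Q = F * mat_diag n (\<lambda>i. complex_of_real (d i ^ m)) \<and>
      mat_diag n (\<lambda>i. complex_of_real (d i ^ m)) = G * (B * A ^\<^sub>m m * C * mat_adjoint Q)" if m: "n < m" for m
  proof -
    obtain Lm where Lm: "Lm \<in> carrier_mat n n" "norm_bound Lm cL"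
      "mat_diag n (\<lambda>i. complex_of_real (d i ^ m)) * L = Lm * mat_diag n (\<lambda>i. complex_of_real (d i ^ m))"
      using cL(2)[of m] m by auto
    obtain Lim where Lim: "Lim \<in> carrier_mat n n" "norm_bound Lim cLi"
      "mat_diag n (\<lambda>i. complex_of_real (d i ^ m)) * Li = Lim * mat_diag n (\<lambda>i. complex_of_real (d i ^ m))"
      using cLi[of m] m by auto
    define F where "F = P1 * T ^\<^sub>m m * P2 * Lm"
    define G where "G = Lim * P3 * Ti ^\<^sub>m m * P4"
    define Tm where "Tm = T ^\<^sub>m m"
    define Tim where "Tim = Ti ^\<^sub>m m"
    define D where "D = mat_diag n (\<lambda>i. complex_of_real (d i ^ m))"
    define E where "E = mat_diag n (\<lambda>i. complex_of_real (\<delta> i ^ m))"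
    define R where "R = mat_adjoint Q"
    define Y where "Y = B * A ^\<^sub>m m * C * R"
    have c: "Tm \<in> carrier_mat n n" "Tim \<in> carrier_mat n n" "D \<in> carrier_mat n n" "E \<in> carrier_mat n n"
      "R \<in> carrier_mat n n" "Lm \<in> carrier_mat n n" "Lim \<in> carrier_mat n n" "L \<in> carrier_mat n n"
      "Li \<in> carrier_mat n n" "B \<in> carrier_mat n n" "Bi \<in> carrier_mat n n" "M0 \<in> carrier_mat n n" "N0 \<in> carrier_mat n n"
      "M \<in> carrier_mat n n" "Mi \<in> carrier_mat n n" "C \<in> carrier_mat n n" "Q \<in> carrier_mat n n"
      using T Q' Lm Lim Li Bi c0 h C
      by (auto simp: Tm_def Tim_def D_def E_def R_def intro!: pow_carrier_mat)
    have TiT: "Tim * Tm = 1\<^sub>m n" unfolding Tm_def Tim_def by (rule pow_mat_inverse[OF T(1,2,4)])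
    have simH: "similar_mat_wit H (mat_diag n (\<lambda>i. complex_of_real (\<delta> i))) M0 N0"
      by (rule similar_mat_witI[OF a(1,2) H0 Hc mat_diag_dim c0(2,3)])
    \<comment> \<open>Both sides are the \<open>m\<close>-th power of \<open>H\<close>. The
      diagonals \<open>\<delta>\<close> and \<open>d\<close> are compared only through it, so their
      orders may differ.\<close>
    have e1: "M0 * E * N0 = M * D * Mi"
      using similar_mat_wit_pow_id[OF simH, of m] similar_mat_wit_pow_id[OF H, of m]
      by (simp add: mat_diag_pow D_def E_def)
    have e2: "E * N0 = N0 * (M * (D * Mi))"
    proof -
      have "E * N0 = (N0 * M0) * (E * N0)" unfolding a(2) using c by (simp add: assoc left_mult_one_mat[of _ n n])
      also have "\<dots> = N0 * (M0 * E * N0)" using c by (simp add: assoc)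
      also have "\<dots> = N0 * (M * (D * Mi))" unfolding e1 using c by (simp add: assoc)
      finally show ?thesis .
    qed
    have e3: "Mi * (M0 * (E * N0)) = D * Mi"
    proof -
      have "Mi * (M0 * (E * N0)) = Mi * (M0 * E * N0)" using c by (simp add: assoc)
      also have "\<dots> = (Mi * M) * (D * Mi)" unfolding e1 using c by (simp add: assoc)
      also have "\<dots> = D * Mi" unfolding h(2) using c by (simp add: assoc left_mult_one_mat[of _ n n])
      finally show ?thesis .
    qed
    have e4: "Mi * (C * R) = L"
    proof -
      have "Mi * (C * R) = (Mi * C) * R" using c by (simp add: assoc)
      also have "\<dots> = L * (Q * R)" unfolding LQ using c by (simp add: assoc)
      also have "\<dots> = L" using c Q'(4) by (simp add: R_def right_mult_one_mat[of _ n n])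
      finally show ?thesis .
    qed
    have Am: "A ^\<^sub>m m = M0 * (Tm * E) * N0"
      using similar_mat_wit_pow_id[OF simA, of m] JT[of m] m by (simp add: Tm_def E_def)
    have "Y = B * (M0 * (Tm * ((E * N0) * (C * R))))" unfolding Y_def Am using c by (simp add: assoc)
    also have "\<dots> = B * (M0 * (Tm * (N0 * (M * (D * (Mi * (C * R)))))))" unfolding e2 using c by (simp add: assoc)
    also have "\<dots> = P1 * (Tm * (P2 * (D * L)))" unfolding e4 P1_def P2_def using c by (simp add: assoc)
    also have "D * L = Lm * D" using Lm(3) by (simp add: D_def)
    also have "P1 * (Tm * (P2 * (Lm * D))) = F * D"
      unfolding F_def Tm_def[symmetric] using c P by (simp add: assoc)
    finally have YF: "Y = F * D" .
    \<comment> \<open>The factors of \<open>G\<close> cancel those of \<open>Y\<close> in turn: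
      \<open>Bi\<close> against \<open>B\<close>, \<open>N0\<close> against \<open>M0\<close>,
      \<open>Tim\<close> against \<open>Tm\<close>. What remains is \<open>D\<close> between
      \<open>Li\<close> and \<open>L\<close>, after moving \<open>Lim\<close> back through
      \<open>D\<close>.\<close>
    have "G * Y = Lim * (Mi * (M0 * (Tim * (N0 * ((Bi * B) * (M0 * (Tm * (E * (N0 * (C * R)))))))))) "
      unfolding G_def Tim_def[symmetric] Y_def Am P3_def P4_def using c by (simp add: assoc)
    also have "\<dots> = Lim * (Mi * (M0 * (Tim * ((N0 * M0) * (Tm * (E * (N0 * (C * R))))))))"
      unfolding Bi(3) using c by (simp add: assoc left_mult_one_mat[of _ n n])
    also have "\<dots> = Lim * (Mi * (M0 * ((Tim * Tm) * (E * (N0 * (C * R))))))"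
      unfolding a(2) using c by (simp add: assoc left_mult_one_mat[of _ n n])
    also have "\<dots> = Lim * ((Mi * (M0 * (E * N0))) * (C * R))"
      unfolding TiT using c by (simp add: assoc left_mult_one_mat[of _ n n])
    also have "\<dots> = Lim * D * (Mi * (C * R))" unfolding e3 using c by (simp add: assoc)
    also have "Lim * D = D * Li" using Lim(3) by (simp add: D_def)
    also have "D * Li * (Mi * (C * R)) = D" unfolding e4 using c Li(4) by (simp add: assoc right_mult_one_mat[of _ n n])
    finally have GY: "D = G * Y" by simp
    have Pc: "P1 * Tm \<in> carrier_mat n n" "P1 * Tm * P2 \<in> carrier_mat n n" "Lim * P3 \<in> carrier_mat n n"
      "Lim * P3 * Tim \<in> carrier_mat n n"
      using c P by (auto simp: assoc)
    let ?p = "1 + real m ^ n"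
    have "norm_bound F (b1 * (cT * ?p) * real n * b2 * real n * cL * real n)"
      unfolding F_def Tm_def[symmetric]
      using norm_bound_mult[OF Pc(2) c(6) norm_bound_mult[OF Pc(1) P(2) norm_bound_mult[OF P(1) c(1) b1(2)] b2(2)] Lm(2)]
        cT(2)[of m] by (simp add: Tm_def)
    hence "norm_bound F (K1 * ?p)" by (simp add: K1_def mult_ac)
    hence FK: "norm_bound F (K * ?p)" by (rule norm_bound_mono) (auto simp: K_def intro!: mult_right_mono)
    have "norm_bound G (cLi * b3 * real n * (cTi * ?p) * real n * b4 * real n)"
      unfolding G_def Tim_def[symmetric]
      using norm_bound_mult[OF Pc(4) P(4) norm_bound_mult[OF Pc(3) c(2) norm_bound_mult[OF c(7) P(3) Lim(2) b3]] b4]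
        cTi(2)[of m] by (simp add: Tim_def)
    hence "norm_bound G (K2 * ?p)" by (simp add: K2_def mult_ac)
    hence GK: "norm_bound G (K * ?p)" by (rule norm_bound_mono) (auto simp: K_def intro!: mult_right_mono)
    have "F \<in> carrier_mat n n" "G \<in> carrier_mat n n"
      unfolding F_def G_def Tm_def[symmetric] Tim_def[symmetric] using c P by (auto simp: assoc)
    thus ?thesis using FK GK YF GY unfolding Y_def D_def R_def by blast
  qed
  thus ?thesis by (rule that[OF K0])
qed

text \<open>Passing from \<open>X m\<close> to \<open>Y = X m * mat_adjoint Q\<close> conjugates the
  Gram matrix by \<open>Q\<close>: the eigenvalues stay and the eigenvectors become
  \<open>W m = Q * U m\<close>. The rotated roots converge to the diagonal matrix, and rotating back
  gives the claim.\<close>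

lemma mat_abs_power_root_LIMSEQ:
  fixes A C B M Mi L H Q :: "complex mat" and d :: "nat \<Rightarrow> real"
  assumes A: "A \<in> carrier_mat n n" and hyp: "hyperbolic_element A H"
    and C: "C \<in> carrier_mat n n" and B: "B \<in> GL n"
    and H: "similar_mat_wit H (mat_diag n (\<lambda>i. complex_of_real (d i))) M Mi"
    and L: "L \<in> GL n" "lower_triangular L" and Q: "Q \<in> unitary_group n" and LQ: "Mi * C = L * Q"
    and d0: "\<And>i. i < n \<Longrightarrow> 0 \<le> d i" and d: "\<And>i j. i \<le> j \<Longrightarrow> j < n \<Longrightarrow> d j \<le> d i"
  shows "mat_LIMSEQ n (\<lambda>m. psd_root m (mat_abs (B * A ^\<^sub>m m * C)))
    (mat_adjoint Q * mat_diag n (\<lambda>i. complex_of_real (d i)) * Q)"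
proof -
  note assoc = assoc_mult_mat[of _ n n _ n _ n] mult_carrier_mat[of _ n n _ n]
  obtain K where K: "0 \<le> K" and FG: "\<And>m. n < m \<Longrightarrow> \<exists>F G. F \<in> carrier_mat n n \<and> G \<in> carrier_mat n n \<and>
      norm_bound F (K * (1 + real m ^ n)) \<and> norm_bound G (K * (1 + real m ^ n)) \<and>
      B * A ^\<^sub>m m * C * mat_adjoint Q = F * mat_diag n (\<lambda>i. complex_of_real (d i ^ m)) \<and>
      mat_diag n (\<lambda>i. complex_of_real (d i ^ m)) = G * (B * A ^\<^sub>m m * C * mat_adjoint Q)"
    using power_factorization_bounds[OF assms] by blast
  note Q' = unitary_groupD[OF Q]
  define X where "X m = B * A ^\<^sub>m m * C" for m
  have Bc: "B \<in> carrier_mat n n" using B by (simp add: GL_def)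
  have X: "X m \<in> carrier_mat n n" for m
    using A C Bc pow_carrier_mat[OF A, of m] by (simp add: X_def assoc)
  have "\<exists>U r. U \<in> unitary_group n \<and> (\<forall>i. 0 \<le> r i) \<and> psd_root m (mat_abs (X m)) = spectral_mat n U r \<and>
    mat_adjoint (X m) * X m = spectral_mat n U (\<lambda>i. (r i ^ m)\<^sup>2)" if "m > 0" for m
    using psd_root_mat_abs[OF X that] by metis
  then obtain U r where U: "\<And>m. m > 0 \<Longrightarrow> U m \<in> unitary_group n" and r: "\<And>m i. m > 0 \<Longrightarrow> 0 \<le> r m i"
    and root: "\<And>m. m > 0 \<Longrightarrow> psd_root m (mat_abs (X m)) = spectral_mat n (U m) (r m)"
    and gram: "\<And>m. m > 0 \<Longrightarrow> mat_adjoint (X m) * X m = spectral_mat n (U m) (\<lambda>i. (r m i ^ m)\<^sup>2)"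
    by metis
  define W where "W m = Q * U m" for m
  have W: "W m \<in> unitary_group n" if "m > 0" for m unfolding W_def by (rule unitary_mult[OF Q U[OF that]])
  \<comment> \<open>The factor \<open>n\<close> is the one lost in
    \<open>singular_vector_bounds\<close>.\<close>
  define q where "q m = real n * (K * (1 + real m ^ n))" for m
  have "mat_LIMSEQ n (\<lambda>m. spectral_mat n (W m) (r m)) (mat_diag n (\<lambda>i. complex_of_real (d i)))"
  proof (rule spectral_mat_LIMSEQ[OF d0])
    show "0 \<le> q m" for m using K by (simp add: q_def)
    show "(\<lambda>m. q m * \<rho> ^ m) \<longlonglongrightarrow> 0" if "0 \<le> \<rho>" "\<rho> < 1" for \<rho> :: real
      using poly_times_geometric_tendsto_0[OF that, of "real n * K" n] by (simp add: q_def mult.assoc)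
    show "\<forall>\<^sub>F m in sequentially. W m \<in> unitary_group n"
      using eventually_gt_at_top[of 0] by eventually_elim (rule W)
    show "\<forall>\<^sub>F m in sequentially. \<forall>j<n. 0 \<le> r m j"
      using eventually_gt_at_top[of 0] by eventually_elim (simp add: r)
    show "\<forall>\<^sub>F m in sequentially. \<forall>i<n. \<forall>j<n.
      d i ^ m * cmod (W m $$ (i,j)) \<le> q m * r m j ^ m \<and> r m j ^ m * cmod (W m $$ (i,j)) \<le> q m * d i ^ m"
      using eventually_gt_at_top[of n]
    proof eventually_elim
      case (elim m)
      hence m: "m > 0" by simp
      define Y where "Y = X m * mat_adjoint Q"
      have Y: "Y \<in> carrier_mat n n" using X Q' by (simp add: Y_def assoc)
      obtain F G where F: "F \<in> carrier_mat n n" "norm_bound F (K * (1 + real m ^ n))"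
          "Y = F * mat_diag n (\<lambda>i. complex_of_real (d i ^ m))"
        and G: "G \<in> carrier_mat n n" "norm_bound G (K * (1 + real m ^ n))"
          "mat_diag n (\<lambda>i. complex_of_real (d i ^ m)) = G * Y"
        using FG[OF elim] unfolding Y_def X_def by blast
      have "mat_adjoint Y * Y = Q * (mat_adjoint (X m) * X m) * mat_adjoint Q"
        unfolding Y_def using X[of m] Q'(1,2) by (simp add: adjoint_mult[of _ n n _ n] assoc)
      hence YY: "mat_adjoint Y * Y = spectral_mat n (W m) (\<lambda>j. (r m j ^ m)\<^sup>2)"
        unfolding gram[OF m] spectral_mat_conj[OF Q U[OF m]] W_def .
      have "0 \<le> r m j ^ m" for j using r[OF m] by simp
      moreover have "0 \<le> d i ^ m" if "i < n" for i using d0[OF that] by simp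
      moreover have "0 \<le> K * (1 + real m ^ n)" using K by simp
      \<comment> \<open>Used with singular values \<open>r m j ^ m\<close> and diagonal entries
        \<open>d i ^ m\<close>.\<close>
      ultimately show ?case
        using singular_vector_bounds[OF Y W[OF m] YY _ _ _ F G] by (simp add: q_def)
    qed
  qed
  from mat_LIMSEQ_mult[OF this Q'(2,1)]
  have "mat_LIMSEQ n (\<lambda>m. mat_adjoint Q * spectral_mat n (W m) (r m) * Q)
    (mat_adjoint Q * mat_diag n (\<lambda>i. complex_of_real (d i)) * Q)" .
  thus ?thesis
  proof (rule mat_LIMSEQ_cong)
    show "\<forall>\<^sub>F m in sequentially. mat_adjoint Q * spectral_mat n (W m) (r m) * Q
        = psd_root m (mat_abs (B * A ^\<^sub>m m * C))"
      using eventually_gt_at_top[of 0]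
    proof eventually_elim
      case (elim m)
      note U' = unitary_groupD[OF U[OF elim]]
      have "mat_adjoint Q * spectral_mat n (W m) (r m) * Q = spectral_mat n (mat_adjoint Q * W m) (r m)"
        using spectral_mat_conj[OF adjoint_unitary[OF Q] W[OF elim], of "r m"] by simp
      also have "mat_adjoint Q * W m = (mat_adjoint Q * Q) * U m"
        unfolding W_def using Q'(1,2) U' by (simp add: assoc)
      also have "\<dots> = U m" unfolding Q'(3) by (rule left_mult_one_mat[OF U'(1)])
      finally show ?case using root[OF elim] by (simp add: X_def)
    qed
  qed
qed

lemma ordered_eigenvalues_length:
  assumes "A \<in> carrier_mat n n" "ordered_eigenvalues A ls"
  shows "length ls = n"
proof -
  have "degree (char_poly A) = length ls"
    using assms(2) degree_linear_factors[of uminus ls] by (simp add: ordered_eigenvalues_def)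
  thus ?thesis using degree_monic_char_poly[OF assms(1)] by simp
qed

lemma ordered_eigenvalues_limit:
  fixes A H C :: "complex mat"
  assumes A: "A \<in> carrier_mat n n" and ls: "ordered_eigenvalues A ls" and D: "D = cmat (modulus_diag ls)"
    and hyp: "hyperbolic_element A H" and C: "C \<in> GL n" and B: "B \<in> GL n" and H: "similar_mat_wit H D M Mi"
    and L: "L \<in> GL n" "lower_triangular L" and Q: "Q \<in> unitary_group n" and LQ: "Mi * C = L * Q"
  shows "mat_LIMSEQ n (\<lambda>m. psd_root m (mat_abs (B * A ^\<^sub>m m * C))) (mat_adjoint Q * D * Q)"
proof -
  have len: "length ls = n" by (rule ordered_eigenvalues_length[OF A ls])
  have D': "D = mat_diag n (\<lambda>i. complex_of_real (cmod (ls ! i)))"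
    unfolding D modulus_diag_def len by (rule eq_matI) (auto simp: mat_diag_def)
  have "cmod (ls ! j) \<le> cmod (ls ! i)" if "i \<le> j" "j < n" for i j
    using ls that len sorted_wrt_nth_less[of "\<lambda>x y. cmod x \<ge> cmod y" ls i j]
    by (cases "i = j") (auto simp: ordered_eigenvalues_def)
  moreover have "C \<in> carrier_mat n n" using C by (simp add: GL_def)
  ultimately show ?thesis
    unfolding D' by (intro mat_abs_power_root_LIMSEQ[OF A hyp _ B H[unfolded D'] L Q LQ]) auto
qed

section \<open>Real matrices and independence of the choices\<close>

lemma one_GL: "1\<^sub>m n \<in> GL n"
  by (auto simp: GL_def invertible_mat_def inverts_mat_def intro!: exI[of _ "1\<^sub>m n"])

lemma cmat_mult:
  "X \<in> carrier_mat n n \<Longrightarrow> Y \<in> carrier_mat n n \<Longrightarrow> cmat (X * Y) = cmat X * cmat Y"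
  by (rule of_real_hom.mat_hom_mult)

lemma cmat_pow: "X \<in> carrier_mat n n \<Longrightarrow> cmat (X ^\<^sub>m k) = cmat X ^\<^sub>m k"
  by (rule of_real_hom.mat_hom_pow)

lemma cmat_eq_iff: "cmat X = cmat Y \<longleftrightarrow> X = Y"
  using of_real_hom.mat_hom_inj by blast

lemma cmat_GL:
  assumes "X \<in> GL n"
  shows "cmat X \<in> GL n"
proof -
  obtain Xi where X: "X \<in> carrier_mat n n" "Xi \<in> carrier_mat n n" "X * Xi = 1\<^sub>m n" "Xi * X = 1\<^sub>m n"
    using GL_inverse[OF assms] .
  have "cmat X * cmat Xi = 1\<^sub>m n" "cmat Xi * cmat X = 1\<^sub>m n"
    using X cmat_mult[OF X(1,2)] cmat_mult[OF X(2,1)] by (simp_all add: of_real_hom.mat_hom_one)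
  thus ?thesis using X by (auto simp: GL_def invertible_mat_def inverts_mat_def intro!: exI[of _ "cmat Xi"])
qed

lemma mat_adjoint_cmat: "mat_adjoint (cmat X) = cmat (transpose_mat X)"
  by (rule eq_matI) auto

lemma cmat_orthogonal_group:
  assumes "Q \<in> orthogonal_group n"
  shows "cmat Q \<in> unitary_group n"
proof (rule unitary_groupI)
  have Q: "Q \<in> carrier_mat n n" "transpose_mat Q \<in> carrier_mat n n" "transpose_mat Q * Q = 1\<^sub>m n"
    using assms by (auto simp: orthogonal_group_def)
  show "cmat Q \<in> carrier_mat n n" using Q by simp
  show "mat_adjoint (cmat Q) * cmat Q = 1\<^sub>m n"
    using cmat_mult[OF Q(2,1)] Q(3) by (simp add: mat_adjoint_cmat of_real_hom.mat_hom_one)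
qed

text \<open>The embedding \<open>cmat\<close> preserves products, powers, invertibility and
  triangularity and turns transposes into adjoints, so the real data are an instance of the complex
  statement.\<close>

lemma ordered_eigenvalues_limit_real:
  fixes A C :: "real mat"
  assumes A: "A \<in> carrier_mat n n" and ls: "ordered_eigenvalues (cmat A) ls" and D: "D = modulus_diag ls"
    and hyp: "hyperbolic_element (cmat A) H" and C: "C \<in> GL n" and B: "B \<in> GL n"
    and M: "M \<in> carrier_mat n n" "Mi \<in> carrier_mat n n" "inverts_mat M Mi" "inverts_mat Mi M"
    and H: "H = cmat (M * D * Mi)"
    and L: "L \<in> GL n" "lower_triangular L" and Q: "Q \<in> orthogonal_group n" and LQ: "Mi * C = L * Q"
  shows "mat_LIMSEQ n (\<lambda>m. psd_root m (mat_abs (cmat (B * A ^\<^sub>m m * C)))) (cmat (transpose_mat Q * D * Q))"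
proof -
  have len: "length ls = n" by (rule ordered_eigenvalues_length[OF _ ls]) (use A in simp)
  have Dc: "D \<in> carrier_mat n n" by (simp add: D modulus_diag_def len)
  have c: "L \<in> carrier_mat n n" "Q \<in> carrier_mat n n" "C \<in> carrier_mat n n" "B \<in> carrier_mat n n"
    "transpose_mat Q \<in> carrier_mat n n"
    using L Q C B by (auto simp: GL_def orthogonal_group_def)
  have "M * Mi = 1\<^sub>m n" "Mi * M = 1\<^sub>m n" using M by (auto simp: inverts_mat_def)
  hence "cmat M * cmat Mi = 1\<^sub>m n" "cmat Mi * cmat M = 1\<^sub>m n"
    using cmat_mult[OF M(1,2)] cmat_mult[OF M(2,1)] by (simp_all add: of_real_hom.mat_hom_one)
  moreover have "H = cmat M * cmat D * cmat Mi"
    unfolding H using cmat_mult[OF mult_carrier_mat[OF M(1) Dc] M(2)] cmat_mult[OF M(1) Dc] by simp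
  ultimately have sim: "similar_mat_wit H (cmat D) (cmat M) (cmat Mi)"
    using M Dc by (intro similar_mat_witI[of _ _ n]) (auto simp: mult_carrier_mat[of _ n n _ n])
  have low: "lower_triangular (cmat L)" using L(2) by (auto simp: lower_triangular_def)
  have LQ': "cmat Mi * cmat C = cmat L * cmat Q"
    using LQ cmat_mult[OF M(2) c(3)] cmat_mult[OF c(1,2)] by simp
  have "cmat (B * A ^\<^sub>m m * C) = cmat B * cmat A ^\<^sub>m m * cmat C" for m
  proof -
    have Am: "A ^\<^sub>m m \<in> carrier_mat n n" using A by (rule pow_carrier_mat)
    show ?thesis
      using cmat_mult[OF mult_carrier_mat[OF c(4) Am] c(3)] cmat_mult[OF c(4) Am]
        cmat_pow[OF A, of m] by simp
  qed
  moreover have "cmat (transpose_mat Q * D * Q) = mat_adjoint (cmat Q) * cmat D * cmat Q"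
    using cmat_mult[OF mult_carrier_mat[OF c(5) Dc] c(2)] cmat_mult[OF c(5) Dc]
    by (simp add: mat_adjoint_cmat)
  ultimately show ?thesis
    using ordered_eigenvalues_limit[OF _ ls _ hyp cmat_GL[OF C] cmat_GL[OF B] sim cmat_GL[OF L(1)] low
        cmat_orthogonal_group[OF Q] LQ'] A D by simp
qed

text \<open>Provides the limit before any admissible choice is made; if no choice is admissible, any
  value will do.\<close>

lemma exists_common_value:
  assumes "\<And>x y. P x \<Longrightarrow> P y \<Longrightarrow> f x = f y"
  shows "\<exists>e. \<forall>x. P x \<longrightarrow> e = f x"
  using assms by metis

text \<open>Independence is expressed by the order of quantifiers: \<open>E\<close> is fixed before
  \<open>B\<close>, \<open>M\<close>, \<open>L\<close> and \<open>Q\<close>. Here \<open>Mi\<close>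
  is the inverse of \<open>M\<close>.\<close>

theorem theorem2p6:
  fixes n :: nat
  shows
    "(\<forall>A H C :: complex mat. \<forall>ls D.
        A \<in> carrier_mat n n \<longrightarrow> ordered_eigenvalues A ls \<longrightarrow> D = cmat (modulus_diag ls) \<longrightarrow>
        hyperbolic_element A H \<longrightarrow> C \<in> GL n \<longrightarrow>
        (\<exists>E. \<forall>B M Mi L Q.
           B \<in> GL n \<longrightarrow> similar_mat_wit H D M Mi \<longrightarrow>
           L \<in> GL n \<longrightarrow> lower_triangular L \<longrightarrow> Q \<in> unitary_group n \<longrightarrow> Mi * C = L * Q \<longrightarrow>
           mat_LIMSEQ n (\<lambda>m. psd_root m (mat_abs (B * A ^\<^sub>m m * C))) E \<and>
           E = mat_adjoint Q * D * Q))
     \<and>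
     (\<forall>A C :: real mat. \<forall>H ls D.
        A \<in> carrier_mat n n \<longrightarrow> ordered_eigenvalues (cmat A) ls \<longrightarrow> D = modulus_diag ls \<longrightarrow>
        hyperbolic_element (cmat A) H \<longrightarrow> C \<in> GL n \<longrightarrow>
        (\<exists>E. \<forall>B M Mi L Q.
           B \<in> GL n \<longrightarrow> M \<in> carrier_mat n n \<longrightarrow> Mi \<in> carrier_mat n n \<longrightarrow>
           inverts_mat M Mi \<longrightarrow> inverts_mat Mi M \<longrightarrow> H = cmat (M * D * Mi) \<longrightarrow>
           L \<in> GL n \<longrightarrow> lower_triangular L \<longrightarrow> Q \<in> orthogonal_group n \<longrightarrow> Mi * C = L * Q \<longrightarrow>
           mat_LIMSEQ n (\<lambda>m. psd_root m (mat_abs (cmat (B * A ^\<^sub>m m * C)))) (cmat E) \<and>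
           E = transpose_mat Q * D * Q))"
proof (intro conjI allI impI)
  fix A H C :: "complex mat" and ls D
  assume a: "A \<in> carrier_mat n n" "ordered_eigenvalues A ls" "D = cmat (modulus_diag ls)"
    "hyperbolic_element A H" "C \<in> GL n"
  \<comment> \<open>The matrices \<open>Q\<close> that arise from some admissible \<open>M\<close>
    and \<open>L\<close>. \<open>B\<close> is left out, as the limit formula does not contain
    it.\<close>
  define ok where "ok = (\<lambda>Q. \<exists>M Mi L. similar_mat_wit H D M Mi \<and> L \<in> GL n \<and> lower_triangular L \<and>
    Q \<in> unitary_group n \<and> Mi * C = L * Q)"
  have lim: "mat_LIMSEQ n (\<lambda>m. psd_root m (mat_abs (B * A ^\<^sub>m m * C))) (mat_adjoint Q * D * Q)"
    if "ok Q" "B \<in> GL n" for B Q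
    using that ordered_eigenvalues_limit[OF a] unfolding ok_def by blast
  \<comment> \<open>Two admissible \<open>Q\<close> describe the limit of one and the same sequence,
    the one with \<open>B\<close> the identity.\<close>
  have "\<exists>E. \<forall>Q. ok Q \<longrightarrow> E = mat_adjoint Q * D * Q"
    by (rule exists_common_value) (rule mat_LIMSEQ_unique[OF lim[OF _ one_GL] lim[OF _ one_GL]])
  then obtain E where E: "\<And>Q. ok Q \<Longrightarrow> E = mat_adjoint Q * D * Q" by blast
  show "\<exists>E. \<forall>B M Mi L Q.
           B \<in> GL n \<longrightarrow> similar_mat_wit H D M Mi \<longrightarrow>
           L \<in> GL n \<longrightarrow> lower_triangular L \<longrightarrow> Q \<in> unitary_group n \<longrightarrow> Mi * C = L * Q \<longrightarrow>
           mat_LIMSEQ n (\<lambda>m. psd_root m (mat_abs (B * A ^\<^sub>m m * C))) E \<and>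
           E = mat_adjoint Q * D * Q"
  proof (intro exI[of _ E] allI impI)
    fix B M Mi L Q :: "complex mat"
    assume B: "B \<in> GL n" and h: "similar_mat_wit H D M Mi" "L \<in> GL n" "lower_triangular L"
      "Q \<in> unitary_group n" "Mi * C = L * Q"
    have ok: "ok Q" unfolding ok_def using h by blast
    show "mat_LIMSEQ n (\<lambda>m. psd_root m (mat_abs (B * A ^\<^sub>m m * C))) E \<and> E = mat_adjoint Q * D * Q"
      using lim[OF ok B] by (simp add: E[OF ok])
  qed
next
  fix A C :: "real mat" and H ls D
  assume a: "A \<in> carrier_mat n n" "ordered_eigenvalues (cmat A) ls" "D = modulus_diag ls"
    "hyperbolic_element (cmat A) H" "C \<in> GL n"
  define ok where "ok = (\<lambda>Q. \<exists>M Mi L. M \<in> carrier_mat n n \<and> Mi \<in> carrier_mat n n \<and>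
    inverts_mat M Mi \<and> inverts_mat Mi M \<and> H = cmat (M * D * Mi) \<and> L \<in> GL n \<and> lower_triangular L \<and>
    Q \<in> orthogonal_group n \<and> Mi * C = L * Q)"
  have lim: "mat_LIMSEQ n (\<lambda>m. psd_root m (mat_abs (cmat (B * A ^\<^sub>m m * C)))) (cmat (transpose_mat Q * D * Q))"
    if "ok Q" "B \<in> GL n" for B Q
    using that ordered_eigenvalues_limit_real[OF a] unfolding ok_def by blast
  \<comment> \<open>As in the complex case; the equality of the complex limits descends because
    \<open>cmat\<close> is injective.\<close>
  have "\<exists>E. \<forall>Q. ok Q \<longrightarrow> E = transpose_mat Q * D * Q"
    by (rule exists_common_value)
      (rule mat_LIMSEQ_unique[OF lim[OF _ one_GL] lim[OF _ one_GL], unfolded cmat_eq_iff])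
  then obtain E where E: "\<And>Q. ok Q \<Longrightarrow> E = transpose_mat Q * D * Q" by blast
  show "\<exists>E. \<forall>B M Mi L Q.
           B \<in> GL n \<longrightarrow> M \<in> carrier_mat n n \<longrightarrow> Mi \<in> carrier_mat n n \<longrightarrow>
           inverts_mat M Mi \<longrightarrow> inverts_mat Mi M \<longrightarrow> H = cmat (M * D * Mi) \<longrightarrow>
           L \<in> GL n \<longrightarrow> lower_triangular L \<longrightarrow> Q \<in> orthogonal_group n \<longrightarrow> Mi * C = L * Q \<longrightarrow>
           mat_LIMSEQ n (\<lambda>m. psd_root m (mat_abs (cmat (B * A ^\<^sub>m m * C)))) (cmat E) \<and>
           E = transpose_mat Q * D * Q"
  proof (intro exI[of _ E] allI impI)
    fix B M Mi L Q :: "real mat"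
    assume B: "B \<in> GL n" and h: "M \<in> carrier_mat n n" "Mi \<in> carrier_mat n n" "inverts_mat M Mi"
      "inverts_mat Mi M" "H = cmat (M * D * Mi)" "L \<in> GL n" "lower_triangular L"
      "Q \<in> orthogonal_group n" "Mi * C = L * Q"
    have ok: "ok Q" unfolding ok_def using h by blast
    show "mat_LIMSEQ n (\<lambda>m. psd_root m (mat_abs (cmat (B * A ^\<^sub>m m * C)))) (cmat E) \<and>
        E = transpose_mat Q * D * Q"
      using lim[OF ok B] by (simp add: E[OF ok])
  qed
qed

end
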